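(* Let $\mathcal{F}=\{f_0\}\cup\{f_p\colon p\in\mathcal{P}\}$ be a uniform covering frame on $\mathbb{R}^d$, with sets $\mathcal{P}[M]\subseteq\mathcal{P}$, $M\geq 1$, as in the context. For any integer $M\geq1$ there exists $C_M\in(0,1)$ such that $C_M\to1$ as $M\to\infty$ and such that for all integers $M\geq 1$, $k\geq1$, all $p\in\mathcal{P}^k$, and all $f\in L^2(\mathbb{R}^d)$, $$\|U[p]f*f_0\|_{L^2}^2+\sum_{q\in\mathcal{P}[M]}\|U[p]f*f_q\|_{L^2}^2\geq C_M\|U[p]f\|_{L^2}^2.$$
   Context: Fourier transform: $\hat f(\xi)=\int_{\mathbb{R}^d}f(x)e^{-2\pi i x\cdot\xi}\,dx$, extended to $L^2(\mathbb{R}^d)$. $|y|_\infty$ is the sup norm, and $Q_R(x)=\{y\in\mathbb{R}^d\colon |y-x|_\infty<R\}$ is the open cube of side length $2R$ centered at $x$. Supports are essential supports (complement of the largest open set where the function vanishes a.e.). Uniform covering frame: Let $\mathcal{P}$ be a countably infinite index set. A uniform covering frame is a family of functions $\mathcal{F}=\{f_0\}\cup\{f_p\colon p\in\mathcal{P}\}$ such that: (i) $f_0\in L^1(\mathbb{R}^d)\cap L^2(\mathbb{R}^d)\cap C^1(\mathbb{R}^d)$, $\hat f_0$ is supported in a compact neighborhood of the origin, and $|\hat f_0(0)|=1$; for each $p\in\mathcal{P}$, $f_p\in L^1(\mathbb{R}^d)\cap L^2(\mathbb{R}^d)$ and $\mathrm{supp}(\hat f_p)$ is compact and connected. (ii)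 (Uniform covering property) For any $R>0$ there is an integer $N>0$ such that for each $p\in\mathcal{P}$ the set $\mathrm{supp}(\hat f_p)$ can be covered by $N$ cubes of side length $2R$ (of the form $Q_R(x)$). (iii) (Frame condition) $|\hat f_0(\xi)|^2+\sum_{p\in\mathcal{P}}|\hat f_p(\xi)|^2=1$ for all $\xi\in\mathbb{R}^d$. Scattering propagator: for $k\ge 1$, $\mathcal{P}^k$ is the $k$-fold Cartesian product. For $p\in\mathcal{P}$, $U[p]f=|f*f_p|$ (pointwise complex modulus); for $p=(p_1,\dots,p_k)\in\mathcal{P}^k$, $U[p]f=U[p_k]U[p_{k-1}]\cdots U[p_1]f$. The sets $\mathcal{P}[m]$: let $c>0$ (denoted $C_1$ in the paper, and not the value of $C_M$ at $M=1$) be the smallest constant for which there exist subsets $\mathcal{P}[m]\subseteq\mathcal{P}$, $m=1,2,\dots$, such that for all integers $m\geq1$, $|\hat f_0(\xi)|^2+\sum_{p\in\mathcal{P}[m]}|\hat f_p(\xi)|^2$ equals $1$ if $\xi\in\overline{Q_{cm}(0)}$ and equals $0$ if $\xi\notin Q_{c(m+1)}(0)$ (such constants and subsets exist for every uniform covering frame); $\{\mathcal{P}[m]\}_{m\geq1}$ is a fixed corresponding family. *)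

theory Defs
  imports "HOL-Analysis.Analysis"
begin

text \<open>
  \<open>\<real>\<^sup>d\<close> is \<open>real ^ 'd\<close>. Elements of \<open>L\<^sup>1\<close> and \<open>L\<^sup>2\<close> are represented by Lebesgue measurable
  complex-valued functions.
\<close>

definition L1 :: "((real ^ 'd) \<Rightarrow> complex) set" where
  "L1 = {f. integrable lebesgue f}"

definition L2 :: "((real ^ 'd) \<Rightarrow> complex) set" where
  "L2 = {f. f \<in> borel_measurable lebesgue \<and> integrable lebesgue (\<lambda>x. (cmod (f x))\<^sup>2)}"

definition L2_norm :: "((real ^ 'd) \<Rightarrow> complex) \<Rightarrow> real" where
  "L2_norm f = sqrt (LINT x|lebesgue. (cmod (f x))\<^sup>2)"

definition C1 :: "((real ^ 'd) \<Rightarrow> complex) set" where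
  "C1 = {f. \<exists>f' :: real ^ 'd \<Rightarrow> (real ^ 'd) \<Rightarrow>\<^sub>L complex.
            (\<forall>x. (f has_derivative blinfun_apply (f' x)) (at x)) \<and> continuous_on UNIV f'}"

text \<open>
  The Fourier transform is only ever applied to elements of \<open>L\<^sup>1 \<inter> L\<^sup>2\<close>, where its extension to
  \<open>L\<^sup>2\<close> is given by the integral; the result is a continuous function, so its pointwise values
  are meaningful.
\<close>

definition fourier :: "((real ^ 'd) \<Rightarrow> complex) \<Rightarrow> (real ^ 'd) \<Rightarrow> complex" where
  "fourier f \<xi> = (LINT x|lebesgue. f x * exp (- 2 * pi * \<i> * complex_of_real (x \<bullet> \<xi>)))"

text \<open>
  For \<open>f, g \<in> L\<^sup>2\<close> the integral converges absolutely at every \<open>x\<close>.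
\<close>

definition convolve ::
  "((real ^ 'd) \<Rightarrow> complex) \<Rightarrow> ((real ^ 'd) \<Rightarrow> complex) \<Rightarrow> (real ^ 'd) \<Rightarrow> complex" where
  "convolve f g x = (LINT y|lebesgue. f y * g (x - y))"

definition ess_support :: "((real ^ 'd) \<Rightarrow> complex) \<Rightarrow> (real ^ 'd) set" where
  "ess_support g = - \<Union>{U. open U \<and> (AE x in lebesgue. x \<in> U \<longrightarrow> g x = 0)}"

definition cube :: "real \<Rightarrow> real ^ 'd \<Rightarrow> (real ^ 'd) set" where
  "cube R x = {y. infnorm (y - x) < R}"

definition uniform_covering_frame ::
  "((real ^ 'd) \<Rightarrow> complex) \<Rightarrow> 'p set \<Rightarrow> ('p \<Rightarrow> (real ^ 'd) \<Rightarrow> complex) \<Rightarrow> bool" where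
  "uniform_covering_frame f0 P F \<longleftrightarrow>
     countable P \<and> infinite P \<and>
     f0 \<in> L1 \<inter> L2 \<inter> C1 \<and>
     (\<exists>K. compact K \<and> 0 \<in> interior K \<and> ess_support (fourier f0) \<subseteq> K) \<and>
     cmod (fourier f0 0) = 1 \<and>
     (\<forall>p\<in>P. F p \<in> L1 \<inter> L2 \<and>
        compact (ess_support (fourier (F p))) \<and> connected (ess_support (fourier (F p)))) \<and>
     (\<forall>R>0. \<exists>N::nat. N > 0 \<and>
        (\<forall>p\<in>P. \<exists>x :: nat \<Rightarrow> real ^ 'd. ess_support (fourier (F p)) \<subseteq> (\<Union>i<N. cube R (x i)))) \<and>
     (\<forall>\<xi>. (\<lambda>p. (cmod (fourier (F p) \<xi>))\<^sup>2) summable_on P \<and>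
        (cmod (fourier f0 \<xi>))\<^sup>2 + (\<Sum>\<^sub>\<infinity>p\<in>P. (cmod (fourier (F p) \<xi>))\<^sup>2) = 1)"

definition propagator1 ::
  "('p \<Rightarrow> (real ^ 'd) \<Rightarrow> complex) \<Rightarrow> 'p \<Rightarrow> ((real ^ 'd) \<Rightarrow> complex) \<Rightarrow> (real ^ 'd) \<Rightarrow> complex" where
  "propagator1 F p f = (\<lambda>x. complex_of_real (cmod (convolve f (F p) x)))"

text \<open>
  A path \<open>(p\<^sub>1, \<dots>, p\<^sub>k) \<in> P\<^sup>k\<close> is a list of length \<open>k\<close> with entries in \<open>P\<close>; its head
  \<open>p\<^sub>1\<close> acts first.
\<close>

primrec propagator ::
  "('p \<Rightarrow> (real ^ 'd) \<Rightarrow> complex) \<Rightarrow> 'p list \<Rightarrow> ((real ^ 'd) \<Rightarrow> complex) \<Rightarrow> (real ^ 'd) \<Rightarrow> complex" where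
  "propagator F [] f = f"
| "propagator F (p # ps) f = propagator F ps (propagator1 F p f)"

text \<open>
  The values of the family at index \<open>0\<close> are irrelevant. For a uniform covering frame all
  the sums below converge, being dominated by the one in the frame condition.
\<close>

definition exhausting_family ::
  "((real ^ 'd) \<Rightarrow> complex) \<Rightarrow> 'p set \<Rightarrow> ('p \<Rightarrow> (real ^ 'd) \<Rightarrow> complex) \<Rightarrow> real \<Rightarrow> (nat \<Rightarrow> 'p set) \<Rightarrow> bool"
  where
  "exhausting_family f0 P F c Pm \<longleftrightarrow>
     (\<forall>m\<ge>1. Pm m \<subseteq> P \<and>
       (\<forall>\<xi>. (\<xi> \<in> closure (cube (c * real m) 0) \<longrightarrow>
              (cmod (fourier f0 \<xi>))\<^sup>2 + (\<Sum>\<^sub>\<infinity>p\<in>Pm m. (cmod (fourier (F p) \<xi>))\<^sup>2) = 1) \<and>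
            (\<xi> \<notin> cube (c * real (m + 1)) 0 \<longrightarrow>
              (cmod (fourier f0 \<xi>))\<^sup>2 + (\<Sum>\<^sub>\<infinity>p\<in>Pm m. (cmod (fourier (F p) \<xi>))\<^sup>2) = 0)))"

definition least_exhausting_constant ::
  "((real ^ 'd) \<Rightarrow> complex) \<Rightarrow> 'p set \<Rightarrow> ('p \<Rightarrow> (real ^ 'd) \<Rightarrow> complex) \<Rightarrow> real \<Rightarrow> bool" where
  "least_exhausting_constant f0 P F c \<longleftrightarrow>
     c > 0 \<and> (\<exists>Pm. exhausting_family f0 P F c Pm) \<and>
     (\<forall>c'>0. (\<exists>Pm. exhausting_family f0 P F c' Pm) \<longrightarrow> c \<le> c')"

end

(*
Let v = h * f_p and g = |v|, so that U[p]f has this form. Take a kernel phi >= 0 whose Fourier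
transform takes values in [0,1], vanishes outside the cube |xi| <= c M and is close to 1 near the
origin. If the Fourier support of v is covered by N cubes Q_R(x_i), then the modulations
phi_i = phi e^(2 pi i x_i . y) satisfy |v * phi_i| <= g * phi, and by Plancherel
  N ||g * phi||^2 >= sum_i ||v * phi_i||^2 >= (inf over Q_R(0) of |phi^|^2) ||v||^2.
On the other side ||g * phi||^2 is bounded by the energy captured by f_0 and the f_q, q in P[M].
A fine covering (R = c/4) gives a positive constant for every M. Since the support is connected, it
also lies in a single cube whose size does not depend on p; with N = 1 the constant tends to 1.

All comparisons of L^2 norms of convolutions reduce to pointwise inequalities between Fourier
multipliers, which need Plancherel only on bounded integrable functions, by density.
*)
theory Submission
  imports Defs "HOL-Probability.Characteristic_Functions"
begin

section \<open>Continuity of translations in \<open>L\<^sup>1\<close>\<close>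

text \<open>The limit 1 conflicts with the factor N of the covering argument: splitting
  \<open>v\<close> over N cubes loses N however large M is, whereas a single cube loses no such
  factor but has to be small against the cube of radius \<open>c * M\<close>. Both bounds come from
  one number N, the covering number for \<open>R = c / 4\<close>: the fine covering gives
  \<open>(1/4)^d / N\<close> for every M, and chaining its cubes along the connected support gives
  one cube of radius \<open>c * N / 2\<close>, hence \<open>(1 - N / M)^(2 * d)\<close> once N \<le>
  M. The constant is the maximum of the two.

  The sum over P[M] may be infinite, while multipliers are compared in finite sums only. Compactness
  of the cube supplies a finite partial sum exceeding any given \<open>\<delta> < 1\<close> there,
  and \<open>\<delta>\<close> then tends to 1.

  No Fourier transform is formed for the input \<open>h\<close> or for \<open>v\<close>, which are
  only in L2; the frequency localisation of \<open>v\<close> enters through the multiplier with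
  symbol \<open>fourier fp\<close>. Fubini is applied on products of \<open>lborel\<close>, so the
  Lebesgue measurable data are replaced by Borel representatives.\<close>

lemma lborel_shift: "distr lborel borel (\<lambda>x. x + t) = (lborel :: 'a::euclidean_space measure)"
proof -
  have "(\<lambda>x. x + t) = (+) t" by (simp add: fun_eq_iff add.commute)
  then show ?thesis by (simp only: lborel_distr_plus)
qed

lemma lborel_reflect: "distr lborel borel (\<lambda>x. t - x) = (lborel :: 'a::euclidean_space measure)"
  by (subst lborel_affine[of "-1" t]) (auto simp: density_1)

lemma
  fixes f :: "'a::euclidean_space \<Rightarrow> 'b::{banach, second_countable_topology}"
  assumes [measurable]: "f \<in> borel_measurable borel"
  shows integrable_shift_iff: "integrable lborel (\<lambda>x. f (x + t)) \<longleftrightarrow> integrable lborel f"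
    and lborel_integral_shift: "(LINT x|lborel. f (x + t)) = (LINT x|lborel. f x)"
    and integrable_reflect_iff: "integrable lborel (\<lambda>x. f (t - x)) \<longleftrightarrow> integrable lborel f"
    and lborel_integral_reflect: "(LINT x|lborel. f (t - x)) = (LINT x|lborel. f x)"
proof -
  have "integrable (distr lborel borel (\<lambda>x. x + t)) f \<longleftrightarrow> integrable lborel (\<lambda>x. f (x + t))"
    by (rule integrable_distr_eq) auto
  then show "integrable lborel (\<lambda>x. f (x + t)) \<longleftrightarrow> integrable lborel f"
    by (simp add: lborel_shift)
  have "integral\<^sup>L (distr lborel borel (\<lambda>x. x + t)) f = (LINT x|lborel. f (x + t))"
    by (rule integral_distr) auto
  then show "(LINT x|lborel. f (x + t)) = (LINT x|lborel. f x)"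
    by (simp add: lborel_shift)
  have "integrable (distr lborel borel (\<lambda>x. t - x)) f \<longleftrightarrow> integrable lborel (\<lambda>x. f (t - x))"
    by (rule integrable_distr_eq) auto
  then show "integrable lborel (\<lambda>x. f (t - x)) \<longleftrightarrow> integrable lborel f"
    by (simp add: lborel_reflect)
  have "integral\<^sup>L (distr lborel borel (\<lambda>x. t - x)) f = (LINT x|lborel. f (t - x))"
    by (rule integral_distr) auto
  then show "(LINT x|lborel. f (t - x)) = (LINT x|lborel. f x)"
    by (simp add: lborel_reflect)
qed

lemma
  fixes f :: "'a::euclidean_space \<Rightarrow> ennreal"
  assumes [measurable]: "f \<in> borel_measurable borel"
  shows nn_integral_shift: "(\<integral>\<^sup>+x. f (x + t) \<partial>lborel) = (\<integral>\<^sup>+x. f x \<partial>lborel)"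
    and nn_integral_reflect: "(\<integral>\<^sup>+x. f (t - x) \<partial>lborel) = (\<integral>\<^sup>+x. f x \<partial>lborel)"
proof -
  have "integral\<^sup>N (distr lborel borel (\<lambda>x. x + t)) f = (\<integral>\<^sup>+x. f (x + t) \<partial>lborel)"
    by (rule nn_integral_distr) auto
  then show "(\<integral>\<^sup>+x. f (x + t) \<partial>lborel) = (\<integral>\<^sup>+x. f x \<partial>lborel)"
    by (simp add: lborel_shift)
  have "integral\<^sup>N (distr lborel borel (\<lambda>x. t - x)) f = (\<integral>\<^sup>+x. f (t - x) \<partial>lborel)"
    by (rule nn_integral_distr) auto
  then show "(\<integral>\<^sup>+x. f (t - x) \<partial>lborel) = (\<integral>\<^sup>+x. f x \<partial>lborel)"
    by (simp add: lborel_reflect)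
qed

lemma integral_lborel_affine:
  fixes f :: "'a::euclidean_space \<Rightarrow> 'b::{banach, second_countable_topology}"
  assumes [measurable]: "f \<in> borel_measurable borel" and c: "c \<noteq> 0"
  shows "(LINT x|lborel. f x) = \<bar>c\<bar>^DIM('a) *\<^sub>R (LINT x|lborel. f (t + c *\<^sub>R x))"
  by (subst lborel_affine[OF c, of t])
     (simp add: integral_density integral_distr)

text \<open>Null sequences are used because dominated convergence applies to sequences.
  Integrability is included so that an approximant known only through this predicate can be
  integrated.\<close>

definition translation_continuous :: "('a::euclidean_space \<Rightarrow> 'b::{banach, second_countable_topology}) \<Rightarrow> bool" where
  "translation_continuous f \<longleftrightarrow> integrable lborel f \<and>
     (\<forall>z. z \<longlonglongrightarrow> 0 \<longrightarrow> (\<lambda>n. LINT x|lborel. norm (f (x + z n) - f x)) \<longlonglongrightarrow> 0)"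

lemma translation_diff_integrable:
  fixes f :: "'a::euclidean_space \<Rightarrow> 'b::{banach, second_countable_topology}"
  assumes f: "integrable lborel f"
  shows "integrable lborel (\<lambda>x. norm (f (x + z) - f x))"
proof -
  have "f \<in> borel_measurable borel" using f by auto
  then show ?thesis
    using f by (intro integrable_norm Bochner_Integration.integrable_diff) (auto simp: integrable_shift_iff)
qed

text \<open>Closedness under L1 limits: passing from f to g and back costs the L1 distance twice,
  once translated and once not, and translation invariance makes both costs equal.\<close>

lemma translation_continuous_approx:
  fixes f :: "'a::euclidean_space \<Rightarrow> 'b::{banach, second_countable_topology}"
  assumes f: "integrable lborel f"
    and approx: "\<And>e. e > 0 \<Longrightarrow> \<exists>g. translation_continuous g \<and> (LINT x|lborel. norm (f x - g x)) \<le> e"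
  shows "translation_continuous f"
  unfolding translation_continuous_def
proof (intro conjI allI impI f)
  fix z :: "nat \<Rightarrow> 'a" assume z: "z \<longlonglongrightarrow> 0"
  show "(\<lambda>n. LINT x|lborel. norm (f (x + z n) - f x)) \<longlonglongrightarrow> 0"
  proof (rule LIMSEQ_I)
    fix r :: real assume "0 < r"
    then obtain g where g: "translation_continuous g" and fg: "(LINT x|lborel. norm (f x - g x)) \<le> r/4"
      using approx[of "r/4"] by auto
    have gi: "integrable lborel g" and gl: "(\<lambda>n. LINT x|lborel. norm (g (x + z n) - g x)) \<longlonglongrightarrow> 0"
      using g z by (auto simp: translation_continuous_def)
    have [measurable]: "f \<in> borel_measurable borel" "g \<in> borel_measurable borel"
      using f gi by auto
    have d: "integrable lborel (\<lambda>x. norm (f x - g x))"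
      using f gi by auto
    have d': "integrable lborel (\<lambda>x. norm (f (x + t) - g (x + t)))" for t
      using integrable_shift_iff[of "\<lambda>x. norm (f x - g x)" t] d by simp
    obtain N where N: "\<And>n. n \<ge> N \<Longrightarrow> (LINT x|lborel. norm (g (x + z n) - g x)) < r/4"
      using LIMSEQ_D[OF gl, of "r/4"] \<open>0 < r\<close> by fastforce
    have "(LINT x|lborel. norm (f (x + z n) - f x)) < r" if "n \<ge> N" for n
    proof -
      have "(LINT x|lborel. norm (f (x + z n) - f x))
          \<le> (LINT x|lborel. norm (f (x + z n) - g (x + z n)) + norm (g (x + z n) - g x) + norm (f x - g x))"
      proof (intro integral_mono)
        fix x
        show "norm (f (x + z n) - f x) \<le> norm (f (x + z n) - g (x + z n)) + norm (g (x + z n) - g x) + norm (f x - g x)"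
          by norm
      qed (intro Bochner_Integration.integrable_add translation_diff_integrable f gi d d')+
      also have "\<dots> = (LINT x|lborel. norm (f (x + z n) - g (x + z n))) + (LINT x|lborel. norm (g (x + z n) - g x))
           + (LINT x|lborel. norm (f x - g x))"
        by (simp add: Bochner_Integration.integral_add translation_diff_integrable f gi d d')
      also have "(LINT x|lborel. norm (f (x + z n) - g (x + z n))) = (LINT x|lborel. norm (f x - g x))"
        using lborel_integral_shift[of "\<lambda>x. norm (f x - g x)" "z n"] by simp
      finally show ?thesis using fg N[OF that] \<open>0 < r\<close> by simp
    qed
    then show "\<exists>no. \<forall>n\<ge>no. norm ((LINT x|lborel. norm (f (x + z n) - f x)) - 0) < r"
      by (auto intro!: exI[of _ N])
  qed
qed

text \<open>Openness gives information at points of U only: a point of U stays in U under small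
  translations. This suffices because U and its translate have the same measure, so the symmetric
  difference has twice the measure of one of its halves.\<close>

lemma translation_continuous_open:
  fixes U :: "'a::euclidean_space set" and c :: "'b::{banach, second_countable_topology}"
  assumes U: "open U" "emeasure lborel U < \<infinity>"
  shows "translation_continuous (\<lambda>x. indicator U x *\<^sub>R c)"
  unfolding translation_continuous_def
proof (intro conjI allI impI)
  have [measurable]: "U \<in> sets borel" using U by auto
  show "integrable lborel (\<lambda>x. indicator U x *\<^sub>R c)"
    using U by (intro integrable_scaleR_left integrable_real_indicator) auto
  have iU: "integrable lborel (indicator U :: 'a \<Rightarrow> real)"
    using U by (intro integrable_real_indicator) auto
  fix z :: "nat \<Rightarrow> 'a" assume z: "z \<longlonglongrightarrow> 0"
  \<comment> \<open>The measure of the points of U that the translation moves out of U. The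
    integrand vanishes off U, so boundary points do not matter.\<close>
  define D where "D n = (LINT x|lborel. indicator U x - indicator U x * indicator U (x + z n) :: real)" for n
  have iP: "integrable lborel (\<lambda>x. indicator U x * indicator U (x + t) :: real)" for t
    by (rule Bochner_Integration.integrable_bound[OF iU]) (auto split: split_indicator)
  have iS: "integrable lborel (\<lambda>x. indicator U (x + t) :: real)" for t
    using iU by (subst integrable_shift_iff) auto
  have "D \<longlonglongrightarrow> (LINT x|(lborel :: 'a measure). (0::real))"
    unfolding D_def
  proof (rule integral_dominated_convergence[where w = "indicator U"])
    show "AE x in lborel. (\<lambda>n. indicator U x - indicator U x * indicator U (x + z n) :: real) \<longlonglongrightarrow> 0"
    proof (rule AE_I2, cases)
      fix x assume x: "x \<in> U"
      have "(\<lambda>n. x + z n) \<longlonglongrightarrow> x"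
        using tendsto_add[OF tendsto_const z, of x] by simp
      then have "eventually (\<lambda>n. x + z n \<in> U) sequentially"
        using U(1) x topological_tendstoD by blast
      then show "(\<lambda>n. indicator U x - indicator U x * indicator U (x + z n) :: real) \<longlonglongrightarrow> 0"
        using x by (intro tendsto_eventually) (auto elim!: eventually_mono)
    qed simp
  qed (auto simp: iU split: split_indicator)
  then have D: "D \<longlonglongrightarrow> 0" by simp
  have "(LINT x|lborel. norm (indicator U (x + z n) *\<^sub>R c - indicator U x *\<^sub>R c)) = 2 * D n * norm c" for n
  proof -
    have "(LINT x|lborel. norm (indicator U (x + z n) *\<^sub>R c - indicator U x *\<^sub>R c))
       = (LINT x|lborel. (indicator U (x + z n) + indicator U x - 2 * (indicator U x * indicator U (x + z n))) * norm c)"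
      by (rule Bochner_Integration.integral_cong) (auto split: split_indicator)
    also have "\<dots> = ((LINT x|lborel. indicator U (x + z n)) + (LINT x|lborel. indicator U x)
         - 2 * (LINT x|lborel. indicator U x * indicator U (x + z n))) * norm c"
      using iU iS iP by simp
    also have "(LINT x|lborel. indicator U (x + z n) :: real) = (LINT x|lborel. indicator U x)"
      by (rule lborel_integral_shift) auto
    finally show ?thesis
      unfolding D_def using iU iP by simp
  qed
  then show "(\<lambda>n. LINT x|lborel. norm (indicator U (x + z n) *\<^sub>R c - indicator U x *\<^sub>R c)) \<longlonglongrightarrow> 0"
    using tendsto_mult_left[OF tendsto_mult_right[OF D, of "norm c"], of 2] by (simp add: mult_ac)
qed

text \<open>Outer regularity reduces indicators of Borel sets to indicators of open sets; sums and
  dominated limits then reach every integrable function.\<close>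

lemma integrable_translation_continuous:
  fixes f :: "'a::euclidean_space \<Rightarrow> 'b::{banach, second_countable_topology}"
  assumes "integrable lborel f"
  shows "translation_continuous f"
  using assms
proof (induction rule: integrable_induct)
  case (base A c)
  then have A: "A \<in> sets borel" "emeasure lborel A < \<infinity>" by auto
  show ?case
  proof (rule translation_continuous_approx)
    show iA: "integrable lborel (\<lambda>x. indicator A x *\<^sub>R c)"
      using A by (intro integrable_scaleR_left integrable_real_indicator) auto
    fix e :: real assume e: "e > 0"
    define e' where "e' = e / (norm c + 1)"
    have e': "e' > 0" using e by (simp add: e'_def add_nonneg_pos)
    obtain U where U: "open U" "A \<subseteq> U" "emeasure lborel (U - A) < e'"
      using outer_regular_lborel[OF A(1) e'] by blast
    have [measurable]: "U \<in> sets borel" "A \<in> sets borel" using U A by auto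
    have "emeasure lborel U = emeasure lborel A + emeasure lborel (U - A)"
      using U by (subst plus_emeasure) (auto simp: Un_absorb1)
    also have "\<dots> < \<infinity>" using A(2) U(3) by (auto simp: less_top[symmetric] intro: order.strict_trans)
    finally have Ufin: "emeasure lborel U < \<infinity>" .
    have "(LINT x|lborel. norm (indicator A x *\<^sub>R c - indicator U x *\<^sub>R c)) = (LINT x|lborel. indicator (U - A) x * norm c)"
      using U(2) by (intro Bochner_Integration.integral_cong) (auto split: split_indicator)
    also have "\<dots> = measure lborel (U - A) * norm c" by simp
    also have "\<dots> \<le> e' * norm c"
      using U(3) e' by (intro mult_right_mono) (auto simp: measure_def enn2real_leI less_imp_le)
    also have "\<dots> \<le> e' * (norm c + 1)" using e' by (intro mult_left_mono) auto
    also have "\<dots> = e" by (simp add: e'_def add_nonneg_eq_0_iff)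
    finally show "\<exists>g. translation_continuous g \<and> (LINT x|lborel. norm (indicator A x *\<^sub>R c - g x)) \<le> e"
      using translation_continuous_open[OF U(1) Ufin, of c] by blast
  qed
next
  case (add f g)
  have i: "integrable lborel f" "integrable lborel g" using add by auto
  show ?case unfolding translation_continuous_def
  proof (intro conjI allI impI)
    show "integrable lborel (\<lambda>x. f x + g x)" using i by auto
    fix z :: "nat \<Rightarrow> 'a" assume z: "z \<longlonglongrightarrow> 0"
    have l: "(\<lambda>n. (LINT x|lborel. norm (f (x + z n) - f x)) + (LINT x|lborel. norm (g (x + z n) - g x))) \<longlonglongrightarrow> 0"
      using add z by (intro tendsto_add_zero) (auto simp: translation_continuous_def)
    have "(LINT x|lborel. norm (f (x + z n) + g (x + z n) - (f x + g x)))
        \<le> (LINT x|lborel. norm (f (x + z n) - f x)) + (LINT x|lborel. norm (g (x + z n) - g x))" for n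
    proof -
      have "(LINT x|lborel. norm (f (x + z n) + g (x + z n) - (f x + g x)))
        \<le> (LINT x|lborel. norm (f (x + z n) - f x) + norm (g (x + z n) - g x))"
      proof (intro integral_mono)
        fix x show "norm (f (x + z n) + g (x + z n) - (f x + g x)) \<le> norm (f (x + z n) - f x) + norm (g (x + z n) - g x)"
          by norm
        show "integrable lborel (\<lambda>x. norm (f (x + z n) + g (x + z n) - (f x + g x)))"
          using translation_diff_integrable[of "\<lambda>x. f x + g x"] i by simp
      qed (intro Bochner_Integration.integrable_add translation_diff_integrable i)
      then show ?thesis by (simp add: translation_diff_integrable i)
    qed
    then show "(\<lambda>n. LINT x|lborel. norm (f (x + z n) + g (x + z n) - (f x + g x))) \<longlonglongrightarrow> 0"
      by (intro tendsto_sandwich[OF _ _ tendsto_const l]) auto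
  qed
next
  case (lim f s)
  have tend: "(\<lambda>i. s i x) \<longlonglongrightarrow> f x" and le: "norm (s i x) \<le> 2 * norm (f x)"
    and IH: "translation_continuous (s i)" for i x
    using lim by auto
  show ?case
  proof (rule translation_continuous_approx)
    show "integrable lborel f" by fact
    fix e :: real assume "e > 0"
    have [measurable]: "f \<in> borel_measurable lborel" "\<And>i. s i \<in> borel_measurable lborel"
      using lim by auto
    have "(\<lambda>i. LINT x|lborel. norm (f x - s i x)) \<longlonglongrightarrow> (LINT x|(lborel :: 'a measure). (0::real))"
    proof (rule integral_dominated_convergence[where w = "\<lambda>x. 3 * norm (f x)"])
      show "integrable lborel (\<lambda>x. 3 * norm (f x))" using lim by auto
      show "AE x in lborel. (\<lambda>i. norm (f x - s i x)) \<longlonglongrightarrow> 0"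
      proof (intro AE_I2 tendsto_norm_zero)
        fix x :: 'a
        from tendsto_diff[OF tendsto_const tend[of x], of "f x"]
        show "(\<lambda>i. f x - s i x) \<longlonglongrightarrow> 0" by simp
      qed
      show "AE x in lborel. norm (norm (f x - s i x)) \<le> 3 * norm (f x)" for i
      proof (rule AE_I2)
        fix x :: 'a
        show "norm (norm (f x - s i x)) \<le> 3 * norm (f x)"
          using le[of i x] norm_triangle_ineq4[of "f x" "s i x"] by simp
      qed
    qed auto
    from order_tendstoD(2)[OF this, of e] \<open>e > 0\<close>
    obtain i where "(LINT x|lborel. norm (f x - s i x)) < e"
      by (auto simp: eventually_sequentially)
    then show "\<exists>g. translation_continuous g \<and> (LINT x|lborel. norm (f x - g x)) \<le> e"
      using IH[of i] by (auto intro!: exI[of _ "s i"])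
  qed
qed

lemma integral_translation_tendsto_zero:
  fixes f :: "'a::euclidean_space \<Rightarrow> 'b::{banach, second_countable_topology}"
  assumes "integrable lborel f" "z \<longlonglongrightarrow> 0"
  shows "(\<lambda>n. LINT x|lborel. norm (f (x + z n) - f x)) \<longlonglongrightarrow> 0"
  using integrable_translation_continuous[OF assms(1)] assms(2) by (auto simp: translation_continuous_def)

section \<open>Gaussian integrals\<close>

lemma
  fixes g :: "'a::euclidean_space \<Rightarrow> real \<Rightarrow> 'b::{real_normed_field, banach, second_countable_topology}"
  assumes g: "\<And>b. b \<in> Basis \<Longrightarrow> integrable lborel (g b)"
  shows integrable_lborel_prod_Basis: "integrable lborel (\<lambda>x. \<Prod>b\<in>Basis. g b (x \<bullet> b))"
    and integral_lborel_prod_Basis: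
      "(LINT x|lborel. (\<Prod>b\<in>Basis. g b (x \<bullet> b))) = (\<Prod>b\<in>Basis. (LINT y|lborel. g b y))"
proof -
  interpret product_sigma_finite "\<lambda>_. lborel :: real measure" ..
  have [measurable]: "b \<in> Basis \<Longrightarrow> g b \<in> borel_measurable borel" for b
    using g[of b] by auto
  have m[measurable]: "(\<lambda>x. \<Prod>b\<in>Basis. g b (x \<bullet> b)) \<in> borel_measurable borel"
    by (rule borel_measurable_prod) measurable
  have s[measurable]: "(\<lambda>f. \<Sum>b\<in>Basis. f b *\<^sub>R b) \<in> (\<Pi>\<^sub>M b\<in>Basis. lborel) \<rightarrow>\<^sub>M (borel :: 'a measure)"
    by (rule borel_measurable_sum) measurable
  have eq: "(\<Prod>b\<in>Basis. g b ((\<Sum>c\<in>Basis. f c *\<^sub>R c) \<bullet> b)) = (\<Prod>b\<in>Basis. g b (f b))" for f :: "'a \<Rightarrow> real"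
    by (intro prod.cong refl) simp
  have "integrable (\<Pi>\<^sub>M b\<in>Basis. lborel) (\<lambda>f. \<Prod>b\<in>Basis. g b (f b))"
    by (rule product_integrable_prod) (auto intro: g)
  then show "integrable lborel (\<lambda>x. \<Prod>b\<in>Basis. g b (x \<bullet> b))"
    by (subst lborel_eq, subst integrable_distr_eq[OF s m]) (simp add: eq)
  have "(LINT x|lborel. (\<Prod>b\<in>Basis. g b (x \<bullet> b))) = (LINT f|(\<Pi>\<^sub>M b\<in>Basis. lborel). (\<Prod>b\<in>Basis. g b (f b)))"
    by (subst lborel_eq, subst integral_distr[OF s m]) (simp add: eq)
  also have "\<dots> = (\<Prod>b\<in>Basis. (LINT y|lborel. g b y))"
    by (rule product_integral_prod) (auto intro: g)
  finally show "(LINT x|lborel. (\<Prod>b\<in>Basis. g b (x \<bullet> b))) = (\<Prod>b\<in>Basis. (LINT y|lborel. g b y))" .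
qed

lemma borel_measurable_cis[measurable (raw)]:
  assumes "f \<in> borel_measurable M"
  shows "(\<lambda>x. cis (f x)) \<in> borel_measurable M"
proof -
  have "cis \<in> borel_measurable borel"
    by (intro borel_measurable_continuous_onI continuous_intros)
  then show ?thesis using assms by measurable
qed

text \<open>Up to the factor \<open>sqrt (2 * pi)\<close> this is the characteristic function of the
  standard normal distribution.\<close>

lemma
  fixes t :: real
  shows integrable_gauss_real: "integrable lborel (\<lambda>x. complex_of_real (exp (- x\<^sup>2 / 2)) * cis (t * x))"
    and integral_gauss_real: "(LINT x|lborel. complex_of_real (exp (- x\<^sup>2 / 2)) * cis (t * x)) = sqrt (2 * pi) * exp (- t\<^sup>2 / 2)"
proof -
  have e: "exp (- x\<^sup>2 / 2) = sqrt (2 * pi) * std_normal_density x" for x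
    by (simp add: std_normal_density_def real_sqrt_mult)
  have i: "integrable lborel std_normal_density"
    using integrable_normal_density[of 1 0] by simp
  have i': "integrable lborel (\<lambda>x. complex_of_real (std_normal_density x) * cis (t * x))"
    by (rule Bochner_Integration.integrable_bound[OF i]) (auto simp: norm_mult)
  show "integrable lborel (\<lambda>x. complex_of_real (exp (- x\<^sup>2 / 2)) * cis (t * x))"
    unfolding e of_real_mult mult.assoc by (intro integrable_mult_right i')
  have "(LINT x|lborel. complex_of_real (std_normal_density x) * cis (t * x)) = char std_normal_distribution t"
    unfolding char_def
    by (subst integral_density) (auto simp: cis_conv_exp scaleR_conv_of_real normal_density_nonneg)
  also have "\<dots> = exp (- t\<^sup>2 / 2)"
    by (simp add: char_std_normal_distribution)
  finally have *: "(LINT x|lborel. complex_of_real (std_normal_density x) * cis (t * x)) = exp (- t\<^sup>2 / 2)" .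
  show "(LINT x|lborel. complex_of_real (exp (- x\<^sup>2 / 2)) * cis (t * x)) = sqrt (2 * pi) * exp (- t\<^sup>2 / 2)"
  proof -
    have "(LINT x|lborel. complex_of_real (exp (- x\<^sup>2 / 2)) * cis (t * x))
      = (LINT x|lborel. sqrt (2 * pi) * (complex_of_real (std_normal_density x) * cis (t * x)))"
      unfolding e of_real_mult mult.assoc ..
    then show ?thesis by (simp add: *)
  qed
qed

text \<open>Normalised as the standard normal density without its constant, not as the Gaussian
  fixed by \<open>fourier\<close>. This is the origin of the factors \<open>sqrt (2 * pi)\<close>
  and of the scale \<open>2 * pi * n\<close> below.\<close>

definition gauss :: "'a::euclidean_space \<Rightarrow> real" where
  "gauss x = exp (- (norm x)\<^sup>2 / 2)"

lemma gauss_measurable[measurable]: "gauss \<in> borel_measurable borel"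
  unfolding gauss_def[abs_def] by measurable

lemma gauss_nonneg[simp]: "0 \<le> gauss x"
  and gauss_le_1: "gauss x \<le> 1"
  by (auto simp: gauss_def)

lemma gauss_cis_prod:
  fixes x t :: "'a::euclidean_space"
  shows "gauss x * cis (x \<bullet> t) = (\<Prod>b\<in>Basis. complex_of_real (exp (- (x \<bullet> b)\<^sup>2 / 2)) * cis ((t \<bullet> b) * (x \<bullet> b)))"
proof -
  have "(norm x)\<^sup>2 = (\<Sum>b\<in>Basis. (x \<bullet> b)\<^sup>2)"
    by (subst power2_norm_eq_inner, subst euclidean_inner) (simp add: power2_eq_square)
  then have "gauss x = (\<Prod>b\<in>Basis. exp (- (x \<bullet> b)\<^sup>2 / 2))"
    by (simp add: gauss_def exp_sum[symmetric] sum_negf sum_divide_distrib)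
  moreover have "cis (x \<bullet> t) = (\<Prod>b\<in>Basis. cis ((t \<bullet> b) * (x \<bullet> b)))"
    by (subst euclidean_inner) (simp add: cis_conv_exp exp_sum[symmetric] sum_distrib_left mult_ac)
  ultimately show ?thesis
    by (simp add: prod.distrib)
qed

lemma
  fixes t :: "'a::euclidean_space"
  shows integrable_gauss_cis: "integrable lborel (\<lambda>x. gauss x * cis (x \<bullet> t))"
    and integral_gauss_cis: "(LINT x|lborel. gauss x * cis (x \<bullet> t)) = sqrt (2 * pi) ^ DIM('a) * gauss t"
proof -
  show "integrable lborel (\<lambda>x. gauss x * cis (x \<bullet> t))"
    unfolding gauss_cis_prod by (intro integrable_lborel_prod_Basis integrable_gauss_real)
  have "(norm t)\<^sup>2 = (\<Sum>b\<in>Basis. (t \<bullet> b)\<^sup>2)"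
    by (subst power2_norm_eq_inner, subst euclidean_inner) (simp add: power2_eq_square)
  then have gt: "gauss t = (\<Prod>b\<in>Basis. exp (- (t \<bullet> b)\<^sup>2 / 2))"
    by (simp add: gauss_def exp_sum[symmetric] sum_negf sum_divide_distrib)
  show "(LINT x|lborel. gauss x * cis (x \<bullet> t)) = sqrt (2 * pi) ^ DIM('a) * gauss t"
    unfolding gauss_cis_prod
    integral_lborel_prod_Basis[OF integrable_gauss_real] integral_gauss_real
    by (simp add: prod.distrib gt)
qed

lemma integrable_gauss: "integrable lborel (gauss :: 'a::euclidean_space \<Rightarrow> real)"
  using integrable_norm[OF integrable_gauss_cis[of "0::'a"]] by simp

lemma integral_gauss: "(LINT x|lborel. gauss (x :: 'a::euclidean_space)) = sqrt (2 * pi) ^ DIM('a)"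
proof -
  have "complex_of_real (LINT x|lborel. gauss (x::'a)) = sqrt (2 * pi) ^ DIM('a)"
    using integral_gauss_cis[of "0::'a"] by (simp add: gauss_def[of 0])
  then show ?thesis by (simp only: of_real_eq_iff of_real_power[symmetric])
qed

lemma integrable_gauss_scaled:
  assumes "a \<noteq> 0"
  shows "integrable lborel (\<lambda>x::'a::euclidean_space. gauss (a *\<^sub>R x))"
proof -
  have "integrable (density (distr lborel borel (\<lambda>x. 0 + a *\<^sub>R x)) (\<lambda>_. \<bar>a\<bar> ^ DIM('a))) (gauss :: 'a \<Rightarrow> real)"
    using integrable_gauss[where 'a='a] by (simp only: lborel_affine[OF assms, of 0, symmetric])
  then have "integrable lborel (\<lambda>x::'a. \<bar>a\<bar> ^ DIM('a) * gauss (a *\<^sub>R x))"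
    by (subst (asm) integrable_density) (auto simp: integrable_distr_eq)
  then show ?thesis using assms by simp
qed

lemma integral_gauss_scaled_cis:
  fixes t :: "'a::euclidean_space"
  assumes "n > 0"
  shows "(LINT \<xi>|lborel. gauss (\<xi> /\<^sub>R n) * cis (\<xi> \<bullet> t)) = n ^ DIM('a) * (sqrt (2 * pi) ^ DIM('a) * gauss (n *\<^sub>R t))"
proof -
  have "(LINT \<xi>|lborel. gauss (\<xi> /\<^sub>R n) * cis (\<xi> \<bullet> t)) = n ^ DIM('a) *\<^sub>R (LINT \<xi>|lborel. gauss \<xi> * cis (\<xi> \<bullet> (n *\<^sub>R t)))"
    using assms
    by (subst integral_lborel_affine[where c = n and t = 0]) (auto simp: mult_ac)
  then show ?thesis
    unfolding integral_gauss_cis by (simp add: scaleR_conv_of_real)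
qed

section \<open>Fourier inversion and the Plancherel theorem\<close>

lemma fourier_lborel:
  assumes "v \<in> borel_measurable borel"
  shows "fourier v \<xi> = (LINT x|lborel. v x * cis (- (2 * pi * (x \<bullet> \<xi>))))"
proof -
  have "fourier v \<xi> = (LINT x|lebesgue. v x * cis (- (2 * pi * (x \<bullet> \<xi>))))"
    unfolding fourier_def cis_conv_exp by (simp add: mult_ac)
  also have "\<dots> = (LINT x|lborel. v x * cis (- (2 * pi * (x \<bullet> \<xi>))))"
  proof (rule integral_completion)
    show "(\<lambda>x. v x * cis (- (2 * pi * (x \<bullet> \<xi>)))) \<in> borel_measurable lborel"
      using assms by measurable
  qed
  finally show ?thesis .
qed

lemma integrable_mult_cis:
  assumes "integrable lborel v" "h \<in> borel_measurable borel"
  shows "integrable lborel (\<lambda>x. v x * cis (h x))"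
  by (rule Bochner_Integration.integrable_bound[OF assms(1)]) (use assms in \<open>auto simp: norm_mult\<close>)

lemma fourier_norm_le:
  assumes "integrable lborel v"
  shows "norm (fourier v \<xi>) \<le> (LINT x|lborel. norm (v x))"
proof -
  have "v \<in> borel_measurable borel" using assms by auto
  then have "norm (fourier v \<xi>) \<le> (LINT x|lborel. norm (v x * cis (- (2 * pi * (x \<bullet> \<xi>)))))"
    by (simp add: fourier_lborel)
  then show ?thesis by (simp add: norm_mult)
qed

lemma continuous_fourier:
  fixes v :: "real ^ 'd \<Rightarrow> complex"
  assumes v: "integrable lborel v"
  shows "continuous_on UNIV (fourier v)"
  unfolding continuous_on_sequentially o_def
proof (intro ballI allI impI)
  fix \<xi> and X :: "nat \<Rightarrow> real ^ 'd"
  assume "(\<forall>n. X n \<in> UNIV) \<and> X \<longlonglongrightarrow> \<xi>"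
  then have X: "X \<longlonglongrightarrow> \<xi>" by simp
  have [measurable]: "v \<in> borel_measurable borel" using v by auto
  show "(\<lambda>n. fourier v (X n)) \<longlonglongrightarrow> fourier v \<xi>"
    unfolding fourier_lborel[OF \<open>v \<in> borel_measurable borel\<close>]
  proof (rule integral_dominated_convergence[where w = "\<lambda>x. norm (v x)"])
    show "AE x in lborel. (\<lambda>n. v x * cis (- (2 * pi * (x \<bullet> X n)))) \<longlonglongrightarrow> v x * cis (- (2 * pi * (x \<bullet> \<xi>)))"
      unfolding cis_conv_exp by (intro AE_I2 tendsto_intros X)
  qed (use v in \<open>auto simp: norm_mult\<close>)
qed

lemma fourier_borel_measurable[measurable]:
  assumes "integrable lborel v"
  shows "fourier v \<in> borel_measurable borel"
  by (intro borel_measurable_continuous_onI continuous_fourier assms)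

text \<open>The substitution \<open>s = z - w /\<^sub>R (2 * pi * n)\<close> makes the Gaussian weight independent of \<open>n\<close>.\<close>

lemma fourier_gauss_mean:
  fixes W :: "real ^ 'd \<Rightarrow> complex"
  assumes W: "integrable lborel W" and n: "n > 0"
  shows "integrable lborel (\<lambda>\<xi>. gauss (\<xi> /\<^sub>R n) * fourier W \<xi> * cis (2 * pi * (z \<bullet> \<xi>)))"
    and "(LINT \<xi>|lborel. gauss (\<xi> /\<^sub>R n) * fourier W \<xi> * cis (2 * pi * (z \<bullet> \<xi>)))
       = (1 / sqrt (2 * pi)) ^ CARD('d) * (LINT w|lborel. gauss w * W (z - w /\<^sub>R (2 * pi * n)))"
proof -
  have [measurable]: "W \<in> borel_measurable borel" using W by auto
  have fW[measurable]: "fourier W \<in> borel_measurable borel" using W by measurable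
  let ?G = "\<lambda>\<xi>::real^'d. gauss (\<xi> /\<^sub>R n)"
  have iG: "integrable lborel ?G"
    using n by (intro integrable_gauss_scaled) auto
  show "integrable lborel (\<lambda>\<xi>. ?G \<xi> * fourier W \<xi> * cis (2 * pi * (z \<bullet> \<xi>)))"
  proof (rule Bochner_Integration.integrable_bound)
    show "integrable lborel (\<lambda>\<xi>. ?G \<xi> * (LINT x|lborel. norm (W x)))"
      using iG by simp
    show "AE \<xi> in lborel. norm (?G \<xi> * fourier W \<xi> * cis (2 * pi * (z \<bullet> \<xi>))) \<le> norm (?G \<xi> * (LINT x|lborel. norm (W x)))"
      using fourier_norm_le[OF W]
      by (intro AE_I2) (auto simp: norm_mult abs_mult intro!: mult_left_mono order_trans[OF _ abs_ge_self])
  qed measurable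
  \<comment> \<open>\<open>fourier W\<close> need not be integrable; the Gaussian weight is what
    makes the double integral absolutely convergent, so that the order of integration may be
    exchanged.\<close>
  have i2: "integrable (lborel \<Otimes>\<^sub>M lborel) (\<lambda>(\<xi>, s). ?G \<xi> * W s * cis (2 * pi * ((z - s) \<bullet> \<xi>)))"
  proof (rule Bochner_Integration.integrable_bound)
    show "integrable (lborel \<Otimes>\<^sub>M lborel) (\<lambda>(\<xi>, s). ?G \<xi> *\<^sub>R W s)"
      by (intro lborel_pair.Fubini_integrable) (use iG W in \<open>auto simp: split_beta'\<close>)
  qed (auto simp: norm_mult)
  have "(LINT \<xi>|lborel. ?G \<xi> * fourier W \<xi> * cis (2 * pi * (z \<bullet> \<xi>)))
     = (LINT \<xi>|lborel. (LINT s|lborel. ?G \<xi> * W s * cis (2 * pi * ((z - s) \<bullet> \<xi>))))"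
  proof (rule Bochner_Integration.integral_cong[OF refl])
    fix \<xi> :: "real ^ 'd"
    have "?G \<xi> * fourier W \<xi> * cis (2 * pi * (z \<bullet> \<xi>)) =
       (LINT s|lborel. ?G \<xi> * cis (2 * pi * (z \<bullet> \<xi>)) * (W s * cis (- (2 * pi * (s \<bullet> \<xi>)))))"
      by (simp add: fourier_lborel)
    also have "\<dots> = (LINT s|lborel. ?G \<xi> * W s * cis (2 * pi * ((z - s) \<bullet> \<xi>)))"
    proof (rule Bochner_Integration.integral_cong[OF refl])
      fix s :: "real ^ 'd"
      have "cis (2 * pi * ((z - s) \<bullet> \<xi>)) = cis (2 * pi * (z \<bullet> \<xi>)) * cis (- (2 * pi * (s \<bullet> \<xi>)))"
        by (simp add: cis_mult inner_diff_left algebra_simps)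
      then show "?G \<xi> * cis (2 * pi * (z \<bullet> \<xi>)) * (W s * cis (- (2 * pi * (s \<bullet> \<xi>)))) = ?G \<xi> * W s * cis (2 * pi * ((z - s) \<bullet> \<xi>))"
        by (simp add: mult_ac)
    qed
    finally show "?G \<xi> * fourier W \<xi> * cis (2 * pi * (z \<bullet> \<xi>)) = (LINT s|lborel. ?G \<xi> * W s * cis (2 * pi * ((z - s) \<bullet> \<xi>)))" .
  qed
  also have "\<dots> = (LINT s|lborel. (LINT \<xi>|lborel. ?G \<xi> * W s * cis (2 * pi * ((z - s) \<bullet> \<xi>))))"
    by (rule lborel_pair.Fubini_integral[symmetric]) (use i2 in simp)
  also have "\<dots> = (LINT s|lborel. W s * (n ^ CARD('d) * (sqrt (2 * pi) ^ CARD('d) * gauss (n *\<^sub>R (2 * pi) *\<^sub>R (z - s)))))"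
  proof (rule Bochner_Integration.integral_cong[OF refl])
    fix s :: "real ^ 'd"
    have "(LINT \<xi>|lborel. ?G \<xi> * W s * cis (2 * pi * ((z - s) \<bullet> \<xi>)))
       = (LINT \<xi>|lborel. W s * (?G \<xi> * cis (\<xi> \<bullet> ((2 * pi) *\<^sub>R (z - s)))))"
      by (intro Bochner_Integration.integral_cong refl) (simp add: inner_commute mult_ac)
    also have "\<dots> = W s * (LINT \<xi>|lborel. ?G \<xi> * cis (\<xi> \<bullet> ((2 * pi) *\<^sub>R (z - s))))"
      by simp
    finally show "(LINT \<xi>|lborel. ?G \<xi> * W s * cis (2 * pi * ((z - s) \<bullet> \<xi>)))
      = W s * (n ^ CARD('d) * (sqrt (2 * pi) ^ CARD('d) * gauss (n *\<^sub>R (2 * pi) *\<^sub>R (z - s))))"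
      using integral_gauss_scaled_cis[OF n, of "(2 * pi) *\<^sub>R (z - s)"] by simp
  qed
  also have "\<dots> = \<bar>- 1 / (2 * pi * n)\<bar> ^ DIM(real^'d) *\<^sub>R
      (LINT w|lborel. W (z + (- 1 / (2 * pi * n)) *\<^sub>R w) * (n ^ CARD('d) * (sqrt (2 * pi) ^ CARD('d) *
          gauss (n *\<^sub>R (2 * pi) *\<^sub>R (z - (z + (- 1 / (2 * pi * n)) *\<^sub>R w))))))"
    by (rule integral_lborel_affine) (use n in simp_all)
  also have "\<dots> = (1 / (2 * pi * n)) ^ CARD('d) *\<^sub>R
      (LINT w|lborel. (n ^ CARD('d) * sqrt (2 * pi) ^ CARD('d)) *\<^sub>R (gauss w * W (z - w /\<^sub>R (2 * pi * n))))"
  proof -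
    have 1: "n *\<^sub>R (2 * pi) *\<^sub>R (z - (z + (- 1 / (2 * pi * n)) *\<^sub>R w)) = w" for w :: "real ^ 'd"
      using n by simp
    have 2: "z + (- 1 / (2 * pi * n)) *\<^sub>R w = z - w /\<^sub>R (2 * pi * n)" for w :: "real ^ 'd"
    proof -
      have "- 1 / (2 * pi * n) = - inverse (2 * pi * n)"
        by (metis inverse_eq_divide minus_divide_left)
      then show ?thesis
        by (simp only: scaleR_minus_left add_uminus_conv_diff)
    qed
    have 3: "\<bar>- 1 / (2 * pi * n)\<bar> = 1 / (2 * pi * n)" using n by simp
    show ?thesis
      unfolding 1 3 by (simp only: 2) (simp add: scaleR_conv_of_real mult_ac)
  qed
  also have "\<dots> = ((1 / (2 * pi * n)) ^ CARD('d) * (n ^ CARD('d) * sqrt (2 * pi) ^ CARD('d))) *\<^sub>R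
      (LINT w|lborel. gauss w * W (z - w /\<^sub>R (2 * pi * n)))"
    by simp
  also have "(1 / (2 * pi * n)) ^ CARD('d) * (n ^ CARD('d) * sqrt (2 * pi) ^ CARD('d)) = (1 / sqrt (2 * pi)) ^ CARD('d)"
  proof -
    have "1 / (2 * pi * n) * n * sqrt (2 * pi) = 1 / sqrt (2 * pi)"
      using n real_sqrt_mult_self[of "2 * pi"] by (simp add: field_simps)
    then show ?thesis by (metis power_mult_distrib mult.assoc)
  qed
  finally show "(LINT \<xi>|lborel. ?G \<xi> * fourier W \<xi> * cis (2 * pi * (z \<bullet> \<xi>)))
       = (1 / sqrt (2 * pi)) ^ CARD('d) * (LINT w|lborel. gauss w * W (z - w /\<^sub>R (2 * pi * n)))"
    by (simp add: scaleR_conv_of_real)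
qed

text \<open>The Gaussian means form an approximate identity: the bound on W provides the dominating
  function \<open>gauss w * B\<close>, continuity of W the pointwise limit.\<close>

lemma fourier_gauss_summable:
  fixes W :: "real ^ 'd \<Rightarrow> complex"
  assumes W: "integrable lborel W" and bdd: "\<And>x. norm (W x) \<le> B" and cont: "continuous_on UNIV W"
  shows "(\<lambda>n. LINT \<xi>|lborel. gauss (\<xi> /\<^sub>R real (Suc n)) * fourier W \<xi> * cis (2 * pi * (z \<bullet> \<xi>))) \<longlonglongrightarrow> W z"
proof -
  have [measurable]: "W \<in> borel_measurable borel" using W by auto
  have "(\<lambda>n. LINT w|lborel. gauss w * W (z - w /\<^sub>R (2 * pi * real (Suc n)))) \<longlonglongrightarrow> (LINT w|lborel. gauss (w::real^'d) * W z)"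
  proof (rule integral_dominated_convergence[where w = "\<lambda>w::real^'d. gauss w * B"])
    show "integrable lborel (\<lambda>w::real^'d. gauss w * B)" using integrable_gauss[where 'a="real^'d"] by simp
    show "AE w in lborel. (\<lambda>n. gauss w * W (z - w /\<^sub>R (2 * pi * real (Suc n)))) \<longlonglongrightarrow> gauss w * W z"
    proof (intro AE_I2 tendsto_mult tendsto_const)
      fix w :: "real ^ 'd"
      have "(\<lambda>n. inverse (real (Suc n)) * inverse (2 * pi)) \<longlonglongrightarrow> 0 * inverse (2 * pi)"
        by (intro tendsto_mult LIMSEQ_inverse_real_of_nat tendsto_const)
      then have "(\<lambda>n. inverse (2 * pi * real (Suc n))) \<longlonglongrightarrow> 0"
        by (simp add: field_simps)
      then have "(\<lambda>n. z - w /\<^sub>R (2 * pi * real (Suc n))) \<longlonglongrightarrow> z - 0 *\<^sub>R w"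
        by (intro tendsto_intros)
      then show "(\<lambda>n. W (z - w /\<^sub>R (2 * pi * real (Suc n)))) \<longlonglongrightarrow> W z"
        using cont by (auto simp: continuous_on_sequentially o_def)
    qed
    show "AE w in lborel. norm (gauss w * W (z - w /\<^sub>R (2 * pi * real (Suc n)))) \<le> gauss w * B" for n
      by (auto simp: norm_mult bdd intro!: mult_left_mono)
  qed measurable
  then have "(\<lambda>n. (1 / sqrt (2 * pi)) ^ CARD('d) * (LINT w|lborel. gauss w * W (z - w /\<^sub>R (2 * pi * real (Suc n)))))
     \<longlonglongrightarrow> (1 / sqrt (2 * pi)) ^ CARD('d) * (LINT w|lborel. gauss (w::real^'d) * W z)"
    by (rule tendsto_mult_left)
  also have "(LINT w|lborel. gauss (w::real^'d) * W z) = (LINT w|lborel. complex_of_real (gauss (w::real^'d))) * W z"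
    by simp
  also have "(LINT w|lborel. complex_of_real (gauss (w::real^'d))) = sqrt (2 * pi) ^ CARD('d)"
    by (simp add: integral_gauss)
  finally show ?thesis
    unfolding fourier_gauss_mean(2)[OF W, of "real (Suc _)", OF of_nat_0_less_iff[THEN iffD2, OF zero_less_Suc]]
    by (simp add: power_one_over)
qed

text \<open>For a nonnegative transform the Gaussian means at the origin increase with n and
  converge to the finite value W(0), so monotone convergence yields integrability of
  \<open>h\<close>. With \<open>h\<close> as dominating function the means at any z then converge to
  the inversion integral.\<close>

lemma
  fixes W :: "real ^ 'd \<Rightarrow> complex" and h :: "real ^ 'd \<Rightarrow> real"
  assumes W: "integrable lborel W" and bdd: "\<And>x. norm (W x) \<le> B" and cont: "continuous_on UNIV W"
    and h: "\<And>\<xi>. fourier W \<xi> = complex_of_real (h \<xi>)" "\<And>\<xi>. 0 \<le> h \<xi>"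
  shows integrable_fourier_nonneg: "integrable lborel h"
    and fourier_inversion_nonneg: "(LINT \<xi>|lborel. h \<xi> * cis (2 * pi * (z \<bullet> \<xi>))) = W z"
proof -
  have "h = (\<lambda>\<xi>. Re (fourier W \<xi>))" by (simp add: h)
  moreover have [measurable]: "fourier W \<in> borel_measurable borel" using W by measurable
  ultimately have [measurable]: "h \<in> borel_measurable borel" by simp
  let ?g = "\<lambda>n \<xi>::real^'d. gauss (\<xi> /\<^sub>R real (Suc n))"
  have lim1: "(\<lambda>n. ?g n \<xi>) \<longlonglongrightarrow> 1" for \<xi> :: "real ^ 'd"
  proof -
    have "(\<lambda>n. exp (- (norm (\<xi> /\<^sub>R real (Suc n)))\<^sup>2 / 2)) \<longlonglongrightarrow> exp (- (norm (0 *\<^sub>R \<xi>))\<^sup>2 / 2)"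
      by (intro tendsto_intros LIMSEQ_inverse_real_of_nat) auto
    then show ?thesis by (simp add: gauss_def del: norm_scaleR)
  qed
  have ig: "integrable lborel (\<lambda>\<xi>. ?g n \<xi> * h \<xi>)" for n
    using integrable_Re[OF fourier_gauss_mean(1)[OF W, of "real (Suc n)" 0]] by (simp add: h)
  have mono: "?g n \<xi> \<le> ?g m \<xi>" if "n \<le> m" for n m and \<xi> :: "real ^ 'd"
  proof -
    have "norm (\<xi> /\<^sub>R real (Suc m)) \<le> norm (\<xi> /\<^sub>R real (Suc n))"
      using that by (auto intro!: mult_right_mono le_imp_inverse_le)
    then have "(norm (\<xi> /\<^sub>R real (Suc m)))\<^sup>2 \<le> (norm (\<xi> /\<^sub>R real (Suc n)))\<^sup>2"
      by (rule power_mono) simp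
    then show ?thesis unfolding gauss_def by simp
  qed
  have "(\<lambda>n. LINT \<xi>|lborel. ?g n \<xi> * h \<xi>) \<longlonglongrightarrow> Re (W 0)"
  proof -
    have "(\<lambda>n. Re (LINT \<xi>|lborel. complex_of_real (?g n \<xi>) * fourier W \<xi> * cis (2 * pi * (0 \<bullet> \<xi>)))) \<longlonglongrightarrow> Re (W 0)"
      by (intro tendsto_Re fourier_gauss_summable[OF W bdd cont])
    moreover have "Re (LINT \<xi>|lborel. complex_of_real (?g n \<xi>) * fourier W \<xi> * cis (2 * pi * (0 \<bullet> \<xi>))) = (LINT \<xi>|lborel. ?g n \<xi> * h \<xi>)" for n
      by (simp add: h of_real_mult[symmetric] del: of_real_mult)
    ultimately show ?thesis by simp
  qed
  then show ih: "integrable lborel h"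
  proof (rule integrable_monotone_convergence[OF ig, rotated 2])
    show "AE \<xi> in lborel. mono (\<lambda>n. ?g n \<xi> * h \<xi>)"
      by (intro AE_I2 monoI mult_right_mono mono h(2))
    show "AE \<xi> in lborel. (\<lambda>n. ?g n \<xi> * h \<xi>) \<longlonglongrightarrow> h \<xi>"
      using tendsto_mult_right[OF lim1] by (intro AE_I2) fastforce
  qed measurable
  have "(\<lambda>n. LINT \<xi>|lborel. complex_of_real (?g n \<xi>) * fourier W \<xi> * cis (2 * pi * (z \<bullet> \<xi>)))
     \<longlonglongrightarrow> (LINT \<xi>|lborel. complex_of_real (h \<xi>) * cis (2 * pi * (z \<bullet> \<xi>)))"
  proof (rule integral_dominated_convergence[where w = h])
    show "AE \<xi> in lborel. (\<lambda>n. complex_of_real (?g n \<xi>) * fourier W \<xi> * cis (2 * pi * (z \<bullet> \<xi>)))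
        \<longlonglongrightarrow> complex_of_real (h \<xi>) * cis (2 * pi * (z \<bullet> \<xi>))"
    proof (rule AE_I2)
      fix \<xi> :: "real ^ 'd"
      have "(\<lambda>n. complex_of_real (?g n \<xi>) * fourier W \<xi> * cis (2 * pi * (z \<bullet> \<xi>)))
        \<longlonglongrightarrow> complex_of_real 1 * fourier W \<xi> * cis (2 * pi * (z \<bullet> \<xi>))"
        by (intro tendsto_intros lim1)
      then show "(\<lambda>n. complex_of_real (?g n \<xi>) * fourier W \<xi> * cis (2 * pi * (z \<bullet> \<xi>)))
        \<longlonglongrightarrow> complex_of_real (h \<xi>) * cis (2 * pi * (z \<bullet> \<xi>))"
        by (simp add: h)
    qed
    show "AE \<xi> in lborel. norm (complex_of_real (?g n \<xi>) * fourier W \<xi> * cis (2 * pi * (z \<bullet> \<xi>))) \<le> h \<xi>" for n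
      using h(2) by (auto simp: h norm_mult intro!: mult_left_le_one_le gauss_le_1)
  qed (use ih in measurable)
  then show "(LINT \<xi>|lborel. h \<xi> * cis (2 * pi * (z \<bullet> \<xi>))) = W z"
    by (rule LIMSEQ_unique) (rule fourier_gauss_summable[OF W bdd cont])
qed

section \<open>Convolution of integrable functions, autocorrelation and Plancherel\<close>

lemma borel_measurable_cnj[measurable (raw)]:
  assumes "f \<in> borel_measurable M"
  shows "(\<lambda>x. cnj (f x)) \<in> borel_measurable M"
proof -
  have "cnj \<in> borel_measurable borel"
    by (intro borel_measurable_continuous_onI continuous_intros)
  then show ?thesis using assms by measurable
qed

lemma convolve_lborel:
  assumes [measurable]: "u \<in> borel_measurable borel" "a \<in> borel_measurable borel"
  shows "convolve u a x = (LINT y|lborel. u y * a (x - y))"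
  unfolding convolve_def by (rule integral_completion) measurable

lemma convolve_measurable[measurable]:
  assumes [measurable]: "u \<in> borel_measurable borel" "a \<in> borel_measurable borel"
  shows "convolve u a \<in> borel_measurable borel"
proof -
  have "(\<lambda>x. LINT y|lborel. u y * a (x - y)) \<in> borel_measurable borel"
    by measurable
  then show ?thesis
    by (subst ext[of "convolve u a", OF convolve_lborel]) auto
qed

lemma integrable_convolve_prod:
  fixes u a :: "real ^ 'd \<Rightarrow> complex"
  assumes u: "integrable lborel u" and a: "integrable lborel a"
  shows "integrable (lborel \<Otimes>\<^sub>M lborel) (\<lambda>(y, x). u y * a (x - y))"
proof (rule lborel_pair.Fubini_integrable)
  have [measurable]: "u \<in> borel_measurable borel" "a \<in> borel_measurable borel" using u a by auto
  show "(\<lambda>(y, x). u y * a (x - y)) \<in> borel_measurable (lborel \<Otimes>\<^sub>M lborel)"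
    by measurable
  have sh: "integrable lborel (\<lambda>x. a (x - y))" for y
    using integrable_shift_iff[of a "- y"] a by simp
  have "(LINT x|lborel. norm (u y * a (x - y))) = norm (u y) * (LINT x|lborel. norm (a x))" for y
    using lborel_integral_shift[of "\<lambda>x. norm (a x)" "- y"] by (simp add: norm_mult)
  then show "integrable lborel (\<lambda>y. LINT x|lborel. norm (case (y, x) of (y, x) \<Rightarrow> u y * a (x - y)))"
    using u by simp
  show "AE y in lborel. integrable lborel (\<lambda>x. case (y, x) of (y, x) \<Rightarrow> u y * a (x - y))"
    using sh by simp
qed

lemma convolve_integrable:
  assumes u: "integrable lborel u" and a: "integrable lborel a"
  shows "integrable lborel (convolve u a)"
proof -
  have m: "u \<in> borel_measurable borel" "a \<in> borel_measurable borel" using u a by auto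
  from lborel_pair.integrable_snd[OF integrable_convolve_prod[OF u a]] show ?thesis
    by (subst ext[of "convolve u a", OF convolve_lborel[OF m]])
qed

lemma fourier_convolve:
  fixes u a :: "real ^ 'd \<Rightarrow> complex"
  assumes u: "integrable lborel u" and a: "integrable lborel a"
  shows "fourier (convolve u a) \<xi> = fourier u \<xi> * fourier a \<xi>"
proof -
  have [measurable]: "u \<in> borel_measurable borel" "a \<in> borel_measurable borel" using u a by auto
  let ?e = "\<lambda>x. cis (- (2 * pi * (x \<bullet> \<xi>)))"
  have i: "integrable (lborel \<Otimes>\<^sub>M lborel) (\<lambda>(y, x). u y * a (x - y) * ?e x)"
    by (rule Bochner_Integration.integrable_bound[OF integrable_convolve_prod[OF u a]])
       (auto simp: norm_mult)
  have "fourier (convolve u a) \<xi> = (LINT x|lborel. (LINT y|lborel. u y * a (x - y) * ?e x))"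
    by (simp add: fourier_lborel convolve_lborel)
  also have "\<dots> = (LINT y|lborel. (LINT x|lborel. u y * a (x - y) * ?e x))"
    by (rule lborel_pair.Fubini_integral[OF i])
  also have "\<dots> = (LINT y|lborel. u y * ?e y * fourier a \<xi>)"
  proof (rule Bochner_Integration.integral_cong[OF refl])
    fix y :: "real ^ 'd"
    have "u y * a (x - y) * ?e x = u y * ?e y * (a (x - y) * ?e (x - y))" for x
      by (simp add: cis_mult inner_diff_left algebra_simps)
    then have "(LINT x|lborel. u y * a (x - y) * ?e x) = (LINT x|lborel. u y * ?e y * (a (x - y) * ?e (x - y)))"
      by (intro Bochner_Integration.integral_cong refl)
    also have "\<dots> = u y * ?e y * (LINT x|lborel. a (x - y) * ?e (x - y))"
      by (rule integral_mult_right_zero)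
    also have "(LINT x|lborel. a (x - y) * ?e (x - y)) = fourier a \<xi>"
      using lborel_integral_shift[of "\<lambda>x. a x * ?e x" "- y"] by (simp add: fourier_lborel)
    finally show "(LINT x|lborel. u y * a (x - y) * ?e x) = u y * ?e y * fourier a \<xi>" .
  qed
  also have "\<dots> = fourier u \<xi> * fourier a \<xi>"
    by (simp add: fourier_lborel)
  finally show ?thesis .
qed

lemma convolve_bounded:
  assumes [measurable]: "u \<in> borel_measurable borel" and u: "\<And>x. norm (u x) \<le> B"
    and a: "integrable lborel a"
  shows "norm (convolve u a x) \<le> B * (LINT y|lborel. norm (a y))"
proof -
  have [measurable]: "a \<in> borel_measurable borel" using a by auto
  have i: "integrable lborel (\<lambda>y. B * norm (a (x - y)))"
    using integrable_reflect_iff[of "\<lambda>y. norm (a y)" x] a by simp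
  have "norm (convolve u a x) \<le> (LINT y|lborel. norm (u y * a (x - y)))"
    by (simp add: convolve_lborel)
  also have "\<dots> \<le> (LINT y|lborel. B * norm (a (x - y)))"
    by (rule Bochner_Integration.integral_mono'[OF i])
       (auto simp: norm_mult intro!: mult_right_mono u mult_nonneg_nonneg order_trans[OF norm_ge_zero u])
  also have "\<dots> = B * (LINT y|lborel. norm (a y))"
    using lborel_integral_reflect[of "\<lambda>y. norm (a y)" x] by simp
  finally show ?thesis .
qed

text \<open>Continuity of translations enters here: an increment of the convolution is at most B
  times the L1 norm of the corresponding increment of a translate of \<open>a\<close>.\<close>

lemma convolve_continuous:
  fixes u a :: "real ^ 'd \<Rightarrow> complex"
  assumes [measurable]: "u \<in> borel_measurable borel" and u: "\<And>x. norm (u x) \<le> B"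
    and a: "integrable lborel a"
  shows "continuous_on UNIV (convolve u a)"
  unfolding continuous_on_sequentially o_def
proof (intro ballI allI impI)
  fix x and X :: "nat \<Rightarrow> real ^ 'd"
  assume "(\<forall>n. X n \<in> UNIV) \<and> X \<longlonglongrightarrow> x"
  then have X: "(\<lambda>n. X n - x) \<longlonglongrightarrow> 0" by (simp add: LIM_zero)
  have [measurable]: "a \<in> borel_measurable borel" using a by auto
  have ir: "integrable lborel (\<lambda>y. a (t - y))" for t
    using integrable_reflect_iff[of a t] a by simp
  have iu: "integrable lborel (\<lambda>y. u y * a (t - y))" for t
    by (rule Bochner_Integration.integrable_bound[OF integrable_mult_right[OF integrable_norm[OF ir[of t]], of B]])
       (auto simp: norm_mult intro!: AE_I2 order_trans[OF mult_right_mono[OF u] abs_ge_self])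
  have "norm (convolve u a (X n) - convolve u a x) \<le> B * (LINT y|lborel. norm (a (y + (X n - x)) - a y))" for n
  proof -
    have id: "integrable lborel (\<lambda>y. norm (a (X n - y) - a (x - y)))"
      by (intro integrable_norm Bochner_Integration.integrable_diff ir)
    have "convolve u a (X n) - convolve u a x = (LINT y|lborel. u y * (a (X n - y) - a (x - y)))"
      using iu by (simp add: convolve_lborel right_diff_distrib)
    also have "norm \<dots> \<le> (LINT y|lborel. norm (u y * (a (X n - y) - a (x - y))))"
      by (rule integral_norm_bound)
    also have "\<dots> \<le> (LINT y|lborel. B * norm (a (X n - y) - a (x - y)))"
      by (rule Bochner_Integration.integral_mono'[OF integrable_mult_right[OF id]])
         (auto simp: norm_mult intro!: mult_right_mono u mult_nonneg_nonneg order_trans[OF norm_ge_zero u])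
    also have "\<dots> = B * (LINT y|lborel. norm (a (y + (X n - x)) - a y))"
      using lborel_integral_reflect[of "\<lambda>y. norm (a (y + (X n - x)) - a y)" x] by (simp add: algebra_simps)
    finally show ?thesis .
  qed
  note le = this
  have "(\<lambda>n. B * (LINT y|lborel. norm (a (y + (X n - x)) - a y))) \<longlonglongrightarrow> B * 0"
    by (intro tendsto_mult_left integral_translation_tendsto_zero a X)
  then have "(\<lambda>n. B * (LINT y|lborel. norm (a (y + (X n - x)) - a y))) \<longlonglongrightarrow> 0"
    by (simp only: mult_zero_right)
  then have "(\<lambda>n. convolve u a (X n) - convolve u a x) \<longlonglongrightarrow> 0"
    by (rule Lim_null_comparison[OF always_eventually[OF allI[OF le]]])
  then show "(\<lambda>n. convolve u a (X n)) \<longlonglongrightarrow> convolve u a x"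
    by (rule LIM_zero_cancel)
qed

text \<open>The dense class on which Plancherel is proved: \<open>fourier\<close> is an absolutely
  convergent integral, the autocorrelation is bounded and continuous, and convolution with an
  integrable function stays in the class.\<close>

definition bounded_L1 :: "(real ^ 'd \<Rightarrow> complex) set" where
  "bounded_L1 = {v. integrable lborel v \<and> (\<exists>B. \<forall>x. norm (v x) \<le> B)}"

lemma fourier_cnj_reflect:
  assumes [measurable]: "v \<in> borel_measurable borel"
  shows "fourier (\<lambda>x. cnj (v (- x))) \<xi> = cnj (fourier v \<xi>)"
proof -
  have "fourier (\<lambda>x. cnj (v (- x))) \<xi> = (LINT x|lborel. cnj (v (- x)) * cis (- (2 * pi * (x \<bullet> \<xi>))))"
    by (simp add: fourier_lborel)
  also have "\<dots> = (LINT x|lborel. cnj (v x * cis (- (2 * pi * (x \<bullet> \<xi>)))))"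
    using lborel_integral_reflect[of "\<lambda>x. cnj (v x * cis (- (2 * pi * (x \<bullet> \<xi>))))" 0] by (simp add: cis_cnj)
  also have "\<dots> = cnj (fourier v \<xi>)"
    unfolding fourier_lborel[OF assms] by (rule Bochner_Integration.integral_cnj)
  finally show ?thesis .
qed

text \<open>The autocorrelation W of \<open>v\<close> is integrable, bounded and continuous, and its
  transform is the nonnegative function |\<open>fourier v\<close>|^2. Inversion for nonnegative
  transforms therefore applies to W, and Plancherel is its case z = 0.\<close>

lemma
  fixes v :: "real ^ 'd \<Rightarrow> complex"
  assumes v: "v \<in> bounded_L1"
  shows integrable_fourier_square: "integrable lborel (\<lambda>\<xi>. (cmod (fourier v \<xi>))\<^sup>2)"
    and plancherel: "(LINT \<xi>|lborel. (cmod (fourier v \<xi>))\<^sup>2) = (LINT x|lborel. (cmod (v x))\<^sup>2)"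
    and inverse_fourier_square:
      "(LINT \<xi>|lborel. (cmod (fourier v \<xi>))\<^sup>2 * cis (2 * pi * (z \<bullet> \<xi>))) = (LINT x|lborel. v x * cnj (v (x - z)))"
proof -
  obtain B where vi: "integrable lborel v" and B: "\<And>x. norm (v x) \<le> B"
    using v by (auto simp: bounded_L1_def)
  have [measurable]: "v \<in> borel_measurable borel" using vi by auto
  define v' where "v' = (\<lambda>x. cnj (v (- x)))"
  have [measurable]: "v' \<in> borel_measurable borel" unfolding v'_def by measurable
  have v'i: "integrable lborel v'"
    using integrable_reflect_iff[of "\<lambda>x. cnj (v x)" 0] vi by (simp add: v'_def)
  define W where "W = convolve v v'"
  have Wi: "integrable lborel W" unfolding W_def by (intro convolve_integrable vi v'i)
  have Wb: "norm (W x) \<le> B * (LINT y|lborel. norm (v' y))" for x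
    unfolding W_def by (rule convolve_bounded) (auto intro: B v'i)
  have Wc: "continuous_on UNIV W"
    unfolding W_def by (rule convolve_continuous) (auto intro: B v'i)
  have WF: "fourier W \<xi> = complex_of_real ((cmod (fourier v \<xi>))\<^sup>2)" for \<xi>
    unfolding W_def fourier_convolve[OF vi v'i] complex_norm_square
    by (simp add: v'_def fourier_cnj_reflect)
  have W: "W z = (LINT x|lborel. v x * cnj (v (x - z)))" for z
    unfolding W_def by (simp add: convolve_lborel) (simp add: v'_def)
  note nonneg = integrable_fourier_nonneg[OF Wi Wb Wc WF] fourier_inversion_nonneg[OF Wi Wb Wc WF]
  show "integrable lborel (\<lambda>\<xi>. (cmod (fourier v \<xi>))\<^sup>2)" using nonneg by simp
  show inv: "(LINT \<xi>|lborel. (cmod (fourier v \<xi>))\<^sup>2 * cis (2 * pi * (z \<bullet> \<xi>))) = (LINT x|lborel. v x * cnj (v (x - z)))" for z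
    using nonneg(2)[of z] by (simp add: W)
  have "complex_of_real (LINT \<xi>|lborel. (cmod (fourier v \<xi>))\<^sup>2) = complex_of_real (LINT x|lborel. (cmod (v x))\<^sup>2)"
    using inv[of 0] by (simp add: complex_norm_square[symmetric] del: of_real_power)
  then show "(LINT \<xi>|lborel. (cmod (fourier v \<xi>))\<^sup>2) = (LINT x|lborel. (cmod (v x))\<^sup>2)"
    by (simp only: of_real_eq_iff)
qed

section \<open>Convolution operators on \<open>L\<^sup>2\<close>\<close>

definition L2_lborel :: "(real ^ 'd \<Rightarrow> complex) set" where
  "L2_lborel = {f. f \<in> borel_measurable borel \<and> integrable lborel (\<lambda>x. (cmod (f x))\<^sup>2)}"

lemma L2_lborel_integrable: "f \<in> L2_lborel \<Longrightarrow> integrable lborel (\<lambda>x. (cmod (f x))\<^sup>2)"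
  by (simp add: L2_lborel_def)

lemma L2_norm_nonneg[simp]: "0 \<le> L2_norm f"
  by (simp add: L2_norm_def)

lemma L2_norm_square:
  assumes [measurable]: "f \<in> borel_measurable borel"
  shows "(L2_norm f)\<^sup>2 = (LINT x|lborel. (cmod (f x))\<^sup>2)"
proof -
  have "(LINT x|lebesgue. (cmod (f x))\<^sup>2) = (LINT x|lborel. (cmod (f x))\<^sup>2)"
    by (rule integral_completion) measurable
  then show ?thesis by (simp add: L2_norm_def)
qed

lemma bounded_L1_subset_L2_lborel: "v \<in> bounded_L1 \<Longrightarrow> v \<in> L2_lborel"
proof -
  assume "v \<in> bounded_L1"
  then obtain B where v: "integrable lborel v" and B: "\<And>x. norm (v x) \<le> B"
    by (auto simp: bounded_L1_def)
  have [measurable]: "v \<in> borel_measurable borel" using v by auto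
  have "integrable lborel (\<lambda>x. (cmod (v x))\<^sup>2)"
    by (rule Bochner_Integration.integrable_bound[OF integrable_mult_right[OF integrable_norm[OF v], of B]])
       (auto simp: power2_eq_square intro!: AE_I2 order_trans[OF mult_right_mono[OF B] abs_ge_self])
  then show ?thesis by (simp add: L2_lborel_def)
qed

lemma norm_add_square_le:
  fixes a b :: "'a::real_normed_vector"
  assumes "\<eta> > 0"
  shows "(norm (a + b))\<^sup>2 \<le> (1 + \<eta>) * (norm a)\<^sup>2 + (1 + 1 / \<eta>) * (norm b)\<^sup>2"
proof -
  have "(norm (a + b))\<^sup>2 \<le> (norm a + norm b)\<^sup>2"
    by (intro power_mono norm_triangle_ineq) simp
  also have "\<dots> = (norm a)\<^sup>2 + (norm b)\<^sup>2 + 2 * (sqrt \<eta> * norm a) * (norm b / sqrt \<eta>)"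
    using assms by (simp add: power2_sum)
  also have "\<dots> \<le> (norm a)\<^sup>2 + (norm b)\<^sup>2 + ((sqrt \<eta> * norm a)\<^sup>2 + (norm b / sqrt \<eta>)\<^sup>2)"
    using sum_squares_bound[of "sqrt \<eta> * norm a" "norm b / sqrt \<eta>"] by simp
  also have "\<dots> = (1 + \<eta>) * (norm a)\<^sup>2 + (1 + 1 / \<eta>) * (norm b)\<^sup>2"
    using assms by (simp add: power_mult_distrib power_divide algebra_simps)
  finally show ?thesis .
qed

lemma L2_lborel_add:
  assumes f: "f \<in> L2_lborel" and g: "g \<in> L2_lborel"
  shows "(\<lambda>x. f x + g x) \<in> L2_lborel"
proof -
  have [measurable]: "f \<in> borel_measurable borel" "g \<in> borel_measurable borel"
    using f g by (auto simp: L2_lborel_def)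
  have "integrable lborel (\<lambda>x. (1 + 1) * (cmod (f x))\<^sup>2 + (1 + 1 / 1) * (cmod (g x))\<^sup>2)"
    using f g by (intro Bochner_Integration.integrable_add integrable_mult_right L2_lborel_integrable)
  then have "integrable lborel (\<lambda>x. (cmod (f x + g x))\<^sup>2)"
    by (rule Bochner_Integration.integrable_bound)
       (use norm_add_square_le[of 1] in \<open>auto intro!: AE_I2 order_trans[OF _ abs_ge_self]\<close>)
  then show ?thesis by (simp add: L2_lborel_def)
qed

lemma L2_lborel_diff:
  assumes f: "f \<in> L2_lborel" and g: "g \<in> L2_lborel"
  shows "(\<lambda>x. f x - g x) \<in> L2_lborel"
  using L2_lborel_add[of f "\<lambda>x. - g x"] assms by (simp add: L2_lborel_def)

text \<open>Minkowski's inequality from the weighted inequality \<open>norm_add_square_le\<close>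
  with the optimal weight \<eta> = |g| / |f|. Adding \<epsilon> to both norms keeps the quotient
  meaningful when one of them vanishes.\<close>

lemma L2_norm_triangle:
  assumes f: "f \<in> L2_lborel" and g: "g \<in> L2_lborel"
  shows "L2_norm (\<lambda>x. f x + g x) \<le> L2_norm f + L2_norm g"
proof -
  have [measurable]: "f \<in> borel_measurable borel" "g \<in> borel_measurable borel"
    using f g by (auto simp: L2_lborel_def)
  let ?a = "L2_norm f" and ?b = "L2_norm g"
  have *: "(L2_norm (\<lambda>x. f x + g x))\<^sup>2 \<le> (1 + \<eta>) * ?a\<^sup>2 + (1 + 1 / \<eta>) * ?b\<^sup>2" if \<eta>: "\<eta> > 0" for \<eta>
  proof -
    have "(L2_norm (\<lambda>x. f x + g x))\<^sup>2 = (LINT x|lborel. (cmod (f x + g x))\<^sup>2)"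
      by (rule L2_norm_square) measurable
    also have "\<dots> \<le> (LINT x|lborel. (1 + \<eta>) * (cmod (f x))\<^sup>2 + (1 + 1 / \<eta>) * (cmod (g x))\<^sup>2)"
    proof (rule integral_mono)
      show "integrable lborel (\<lambda>x. (cmod (f x + g x))\<^sup>2)"
        by (rule L2_lborel_integrable[OF L2_lborel_add[OF f g]])
      show "integrable lborel (\<lambda>x. (1 + \<eta>) * (cmod (f x))\<^sup>2 + (1 + 1 / \<eta>) * (cmod (g x))\<^sup>2)"
        using f g by (intro Bochner_Integration.integrable_add integrable_mult_right L2_lborel_integrable)
    qed (rule norm_add_square_le[OF \<eta>])
    also have "\<dots> = (1 + \<eta>) * ?a\<^sup>2 + (1 + 1 / \<eta>) * ?b\<^sup>2"
      using f g by (simp add: L2_lborel_integrable L2_norm_square)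
    finally show ?thesis .
  qed
  have le: "(L2_norm (\<lambda>x. f x + g x))\<^sup>2 \<le> (?a + ?b + 2 * \<epsilon>)\<^sup>2" if "\<epsilon> > 0" for \<epsilon>
  proof -
    let ?a' = "?a + \<epsilon>" and ?b' = "?b + \<epsilon>"
    have p: "?a' > 0" "?b' > 0" using that by (auto intro: add_nonneg_pos)
    have "(L2_norm (\<lambda>x. f x + g x))\<^sup>2 \<le> (1 + ?b' / ?a') * ?a\<^sup>2 + (1 + 1 / (?b' / ?a')) * ?b\<^sup>2"
      using p by (intro *) simp
    also have "\<dots> \<le> (1 + ?b' / ?a') * ?a'\<^sup>2 + (1 + 1 / (?b' / ?a')) * ?b'\<^sup>2"
      using p that by (intro add_mono mult_left_mono power_mono) (auto simp: add_nonneg_nonneg divide_nonneg_pos)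
    also have "\<dots> = (?a' + ?b')\<^sup>2"
    proof -
      have "(1 + b / a) * a\<^sup>2 = a\<^sup>2 + a * b" "(1 + 1 / (b / a)) * b\<^sup>2 = b\<^sup>2 + a * b"
        if "a > 0" "b > 0" for a b :: real
        using that by (simp_all add: field_simps power2_eq_square)
      from this[OF p] show ?thesis by (simp only: power2_sum)
    qed
    finally show ?thesis by (simp add: algebra_simps)
  qed
  have "L2_norm (\<lambda>x. f x + g x) \<le> ?a + ?b + e" if "e > 0" for e
    using le[of "e/2"] that by (auto intro: power2_le_imp_le)
  then show ?thesis by (rule field_le_epsilon)
qed

lemma L2_norm_diff_abs:
  assumes f: "f \<in> L2_lborel" and g: "g \<in> L2_lborel"
  shows "\<bar>L2_norm f - L2_norm g\<bar> \<le> L2_norm (\<lambda>x. f x - g x)"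
proof -
  have "L2_norm f \<le> L2_norm (\<lambda>x. f x - g x) + L2_norm g"
    using L2_norm_triangle[OF L2_lborel_diff[OF f g] g] by simp
  moreover have "L2_norm g \<le> L2_norm (\<lambda>x. g x - f x) + L2_norm f"
    using L2_norm_triangle[OF L2_lborel_diff[OF g f] f] by simp
  moreover have "L2_norm (\<lambda>x. g x - f x) = L2_norm (\<lambda>x. f x - g x)"
    by (simp add: L2_norm_def norm_minus_commute)
  ultimately show ?thesis by linarith
qed

lemma integrable_mult_reflect:
  assumes u: "u \<in> L2_lborel" and a: "a \<in> L2_lborel"
  shows "integrable lborel (\<lambda>y. u y * a (x - y))"
proof -
  have [measurable]: "u \<in> borel_measurable borel" "a \<in> borel_measurable borel"
    using u a by (auto simp: L2_lborel_def)
  have "integrable lborel (\<lambda>y. (cmod (u y))\<^sup>2 + (cmod (a (x - y)))\<^sup>2)"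
    using integrable_reflect_iff[of "\<lambda>y. (cmod (a y))\<^sup>2" x] u a
    by (intro Bochner_Integration.integrable_add) (auto simp: L2_lborel_integrable)
  then show ?thesis
  proof (rule Bochner_Integration.integrable_bound)
    have "cmod (u y) * cmod (a (x - y)) \<le> (cmod (u y))\<^sup>2 + (cmod (a (x - y)))\<^sup>2" for y
    proof -
      have "2 * (cmod (u y) * cmod (a (x - y))) \<le> (cmod (u y))\<^sup>2 + (cmod (a (x - y)))\<^sup>2"
        using sum_squares_bound[of "cmod (u y)" "cmod (a (x - y))"] by simp
      moreover have "0 \<le> cmod (u y) * cmod (a (x - y))" by simp
      ultimately show ?thesis by linarith
    qed
    then show "AE y in lborel. norm (u y * a (x - y)) \<le> norm ((cmod (u y))\<^sup>2 + (cmod (a (x - y)))\<^sup>2)"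
      by (intro AE_I2) (simp add: norm_mult)
  qed measurable
qed

lemma convolve_diff_left:
  assumes u: "u \<in> L2_lborel" "v \<in> L2_lborel" and a: "a \<in> L2_lborel"
  shows "convolve (\<lambda>x. u x - v x) a = (\<lambda>x. convolve u a x - convolve v a x)"
proof
  fix x
  have [measurable]: "u \<in> borel_measurable borel" "v \<in> borel_measurable borel" "a \<in> borel_measurable borel"
    using u a by (auto simp: L2_lborel_def)
  show "convolve (\<lambda>x. u x - v x) a x = convolve u a x - convolve v a x"
    using integrable_mult_reflect[OF u(1) a, of x] integrable_mult_reflect[OF u(2) a, of x]
    by (simp add: convolve_lborel left_diff_distrib)
qed

text \<open>Cauchy-Schwarz applied to the splitting |u| |a| = \<open>sqrt |a|\<close> times
  \<open>|u| sqrt |a|\<close>. In \<open>ennreal\<close> no convergence has to be known in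
  advance.\<close>

lemma convolve_norm_square_le:
  fixes u a :: "real ^ 'd \<Rightarrow> complex"
  assumes [measurable]: "u \<in> borel_measurable borel" "a \<in> borel_measurable borel"
  shows "ennreal ((cmod (convolve u a x))\<^sup>2) \<le>
    (\<integral>\<^sup>+y. cmod (a y) \<partial>lborel) * (\<integral>\<^sup>+y. ennreal ((cmod (u y))\<^sup>2) * cmod (a (x - y)) \<partial>lborel)"
proof -
  have "ennreal (cmod (convolve u a x)) \<le> (\<integral>\<^sup>+y. norm (u y * a (x - y)) \<partial>lborel)"
  \<comment> \<open>If the integrand is not integrable, the convolution has the default value 0 at
    this point and the bound is trivial.\<close>
  proof (cases "integrable lborel (\<lambda>y. u y * a (x - y))")
    case True
    then show ?thesis by (simp only: convolve_lborel assms) (rule integral_norm_bound_ennreal)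
  qed (simp add: convolve_lborel not_integrable_integral_eq)
  also have "\<dots> = (\<integral>\<^sup>+y. ennreal (sqrt (cmod (a (x - y)))) * ennreal (cmod (u y) * sqrt (cmod (a (x - y)))) \<partial>lborel)"
    by (intro nn_integral_cong) (simp add: ennreal_mult[symmetric] norm_mult)
  finally have "(ennreal (cmod (convolve u a x)))\<^sup>2 \<le>
      (\<integral>\<^sup>+y. ennreal (sqrt (cmod (a (x - y)))) * ennreal (cmod (u y) * sqrt (cmod (a (x - y)))) \<partial>lborel)\<^sup>2"
    by (rule power_mono) simp
  also have "\<dots> \<le> (\<integral>\<^sup>+y. (ennreal (sqrt (cmod (a (x - y)))))\<^sup>2 \<partial>lborel) *
      (\<integral>\<^sup>+y. (ennreal (cmod (u y) * sqrt (cmod (a (x - y)))))\<^sup>2 \<partial>lborel)"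
    by (rule Cauchy_Schwarz_nn_integral) measurable
  also have "(\<integral>\<^sup>+y. (ennreal (sqrt (cmod (a (x - y)))))\<^sup>2 \<partial>lborel) = (\<integral>\<^sup>+y. cmod (a y) \<partial>lborel)"
    using nn_integral_reflect[of "\<lambda>y. ennreal (cmod (a y))" x] by (simp add: ennreal_power)
  also have "(\<integral>\<^sup>+y. (ennreal (cmod (u y) * sqrt (cmod (a (x - y)))))\<^sup>2 \<partial>lborel)
     = (\<integral>\<^sup>+y. ennreal ((cmod (u y))\<^sup>2) * cmod (a (x - y)) \<partial>lborel)"
    by (intro nn_integral_cong) (simp add: ennreal_power ennreal_mult[symmetric] power_mult_distrib)
  finally show ?thesis by (simp add: ennreal_power)
qed

text \<open>Young's inequality for L1 and L2: integrate the pointwise bound and exchange the order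
  by Tonelli. Finiteness of the outcome gives membership in L2 together with the norm bound.\<close>

lemma
  fixes u a :: "real ^ 'd \<Rightarrow> complex"
  assumes u: "u \<in> L2_lborel" and a: "integrable lborel a"
  shows convolve_L2_lborel: "convolve u a \<in> L2_lborel"
    and L2_norm_convolve_le: "L2_norm (convolve u a) \<le> (LINT x|lborel. cmod (a x)) * L2_norm u"
proof -
  have [measurable]: "u \<in> borel_measurable borel" "a \<in> borel_measurable borel"
    using u a by (auto simp: L2_lborel_def)
  let ?A = "LINT x|lborel. cmod (a x)"
  have A: "(\<integral>\<^sup>+y. cmod (a y) \<partial>lborel) = ennreal ?A"
    by (rule nn_integral_eq_integral) (use a in auto)
  have U: "(\<integral>\<^sup>+y. ennreal ((cmod (u y))\<^sup>2) \<partial>lborel) = ennreal ((L2_norm u)\<^sup>2)"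
    using u by (subst nn_integral_eq_integral) (auto simp: L2_lborel_integrable L2_norm_square)
  have "(\<integral>\<^sup>+x. ennreal ((cmod (convolve u a x))\<^sup>2) \<partial>lborel)
      \<le> (\<integral>\<^sup>+x. ?A * (\<integral>\<^sup>+y. ennreal ((cmod (u y))\<^sup>2) * cmod (a (x - y)) \<partial>lborel) \<partial>lborel)"
    using convolve_norm_square_le[of u a] by (intro nn_integral_mono) (simp add: A)
  also have "\<dots> = ?A * (\<integral>\<^sup>+x. (\<integral>\<^sup>+y. ennreal ((cmod (u y))\<^sup>2) * cmod (a (x - y)) \<partial>lborel) \<partial>lborel)"
    by (rule nn_integral_cmult) measurable
  also have "(\<integral>\<^sup>+x. (\<integral>\<^sup>+y. ennreal ((cmod (u y))\<^sup>2) * cmod (a (x - y)) \<partial>lborel) \<partial>lborel)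
      = (\<integral>\<^sup>+y. (\<integral>\<^sup>+x. ennreal ((cmod (u y))\<^sup>2) * cmod (a (x - y)) \<partial>lborel) \<partial>lborel)"
    by (rule lborel_pair.Fubini') measurable
  also have "\<dots> = (\<integral>\<^sup>+y. ennreal ((cmod (u y))\<^sup>2) * ?A \<partial>lborel)"
  proof (rule nn_integral_cong)
    fix y
    have "(\<integral>\<^sup>+x. ennreal ((cmod (u y))\<^sup>2) * cmod (a (x - y)) \<partial>lborel)
      = ennreal ((cmod (u y))\<^sup>2) * (\<integral>\<^sup>+x. cmod (a (x - y)) \<partial>lborel)"
      by (rule nn_integral_cmult) measurable
    also have "(\<integral>\<^sup>+x. cmod (a (x - y)) \<partial>lborel) = ?A"
      using nn_integral_shift[of "\<lambda>x. ennreal (cmod (a x))" "- y"] A by simp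
    finally show "(\<integral>\<^sup>+x. ennreal ((cmod (u y))\<^sup>2) * cmod (a (x - y)) \<partial>lborel) = ennreal ((cmod (u y))\<^sup>2) * ?A" .
  qed
  also have "\<dots> = ennreal ((L2_norm u)\<^sup>2) * ?A"
    by (subst nn_integral_multc) (auto simp: U)
  also have "?A * (ennreal ((L2_norm u)\<^sup>2) * ?A) = ennreal ((?A * L2_norm u)\<^sup>2)"
    by (simp add: ennreal_mult[symmetric] power_mult_distrib power2_eq_square mult_ac)
  finally have le: "(\<integral>\<^sup>+x. ennreal ((cmod (convolve u a x))\<^sup>2) \<partial>lborel) \<le> ennreal ((?A * L2_norm u)\<^sup>2)" .
  have i: "integrable lborel (\<lambda>x. (cmod (convolve u a x))\<^sup>2)"
    using le by (intro integrableI_bounded) (auto intro: order.strict_trans1)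
  then show "convolve u a \<in> L2_lborel"
    by (simp add: L2_lborel_def)
  have "(L2_norm (convolve u a))\<^sup>2 \<le> (?A * L2_norm u)\<^sup>2"
    using le i by (subst (asm) nn_integral_eq_integral) (auto simp: L2_norm_square)
  then show "L2_norm (convolve u a) \<le> ?A * L2_norm u"
    by (rule power2_le_imp_le) simp
qed

section \<open>Fourier multipliers on L2 and their comparison\<close>

text \<open>The symbol \<open>m\<close> is tied to \<open>T\<close> only on
  \<open>bounded_L1\<close>, where \<open>fourier\<close> is a convergent integral. Compatibility
  with differences and the norm bound are what carries norm inequalities over to L2 limits;
  invariance of \<open>bounded_L1\<close> permits composition and Plancherel for
  \<open>T u\<close>.\<close>

definition fourier_multiplier ::
  "((real ^ 'd \<Rightarrow> complex) \<Rightarrow> (real ^ 'd \<Rightarrow> complex)) \<Rightarrow> (real ^ 'd \<Rightarrow> complex) \<Rightarrow> bool" where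
  "fourier_multiplier T m \<longleftrightarrow>
     (\<forall>u\<in>L2_lborel. T u \<in> L2_lborel) \<and>
     (\<forall>u\<in>L2_lborel. \<forall>v\<in>L2_lborel. T (\<lambda>x. u x - v x) = (\<lambda>x. T u x - T v x)) \<and>
     (\<exists>C\<ge>0. \<forall>u\<in>L2_lborel. L2_norm (T u) \<le> C * L2_norm u) \<and>
     (\<forall>u\<in>bounded_L1. T u \<in> bounded_L1 \<and> (\<forall>\<xi>. fourier (T u) \<xi> = m \<xi> * fourier u \<xi>))"

lemma fourier_multiplier_id: "fourier_multiplier (\<lambda>u. u) (\<lambda>_. 1)"
  by (auto simp: fourier_multiplier_def intro: exI[of _ 1])

lemma fourier_multiplier_convolve:
  assumes a: "integrable lborel a" "a \<in> L2_lborel"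
  shows "fourier_multiplier (\<lambda>u. convolve u a) (fourier a)"
  unfolding fourier_multiplier_def
proof (intro conjI ballI allI)
  show "\<exists>C\<ge>0. \<forall>u\<in>L2_lborel. L2_norm (convolve u a) \<le> C * L2_norm u"
    using L2_norm_convolve_le[OF _ a(1)] by (intro exI[of _ "LINT x|lborel. cmod (a x)"]) auto
  fix u assume u: "u \<in> (bounded_L1 :: (real ^ 'a \<Rightarrow> complex) set)"
  then obtain B where ui: "integrable lborel u" and B: "\<And>x. norm (u x) \<le> B"
    by (auto simp: bounded_L1_def)
  show "convolve u a \<in> bounded_L1"
    using convolve_integrable[OF ui a(1)] convolve_bounded[OF borel_measurable_integrable[OF ui, simplified] B a(1)]
    unfolding bounded_L1_def by blast
  show "fourier (convolve u a) \<xi> = fourier a \<xi> * fourier u \<xi>" for \<xi>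
    using fourier_convolve[OF ui a(1)] by simp
qed (auto intro: convolve_L2_lborel convolve_diff_left a)

lemma fourier_multiplier_compose:
  assumes S: "fourier_multiplier S k" and T: "fourier_multiplier T m"
  shows "fourier_multiplier (\<lambda>u. T (S u)) (\<lambda>\<xi>. m \<xi> * k \<xi>)"
proof -
  obtain C D where C: "C \<ge> 0" "\<And>u. u \<in> L2_lborel \<Longrightarrow> L2_norm (S u) \<le> C * L2_norm u"
    and D: "D \<ge> 0" "\<And>u. u \<in> L2_lborel \<Longrightarrow> L2_norm (T u) \<le> D * L2_norm u"
    using S T unfolding fourier_multiplier_def by metis
  have "L2_norm (T (S u)) \<le> (D * C) * L2_norm u" if u: "u \<in> L2_lborel" for u
  proof -
    have "S u \<in> L2_lborel" using S u by (simp add: fourier_multiplier_def)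
    then have "L2_norm (T (S u)) \<le> D * L2_norm (S u)" by (rule D)
    also have "\<dots> \<le> D * (C * L2_norm u)" by (intro mult_left_mono C u D)
    finally show ?thesis by (simp add: mult.assoc)
  qed
  moreover have "0 \<le> D * C" using C D by simp
  ultimately show ?thesis
    using S T unfolding fourier_multiplier_def by (auto simp: mult.assoc)
qed

lemma L2_norm_multiplier:
  assumes T: "fourier_multiplier T m" and u: "u \<in> bounded_L1"
  shows "integrable lborel (\<lambda>\<xi>. (cmod (m \<xi>))\<^sup>2 * (cmod (fourier u \<xi>))\<^sup>2)"
    and "(L2_norm (T u))\<^sup>2 = (LINT \<xi>|lborel. (cmod (m \<xi>))\<^sup>2 * (cmod (fourier u \<xi>))\<^sup>2)"
proof -
  have Tu: "T u \<in> bounded_L1" and F: "\<And>\<xi>. fourier (T u) \<xi> = m \<xi> * fourier u \<xi>"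
    using T u by (auto simp: fourier_multiplier_def)
  have "T u \<in> borel_measurable borel" using Tu by (auto simp: bounded_L1_def)
  then show "(L2_norm (T u))\<^sup>2 = (LINT \<xi>|lborel. (cmod (m \<xi>))\<^sup>2 * (cmod (fourier u \<xi>))\<^sup>2)"
    using plancherel[OF Tu] by (simp add: L2_norm_square F norm_mult power_mult_distrib)
  show "integrable lborel (\<lambda>\<xi>. (cmod (m \<xi>))\<^sup>2 * (cmod (fourier u \<xi>))\<^sup>2)"
    using integrable_fourier_square[OF Tu] by (simp add: F norm_mult power_mult_distrib)
qed

text \<open>Truncation at level n both in space and in value: at each point the truncated function
  eventually equals u, and |u|^2 dominates the squared error.\<close>

lemma bounded_L1_dense:
  assumes u: "u \<in> L2_lborel"
  shows "\<exists>s. (\<forall>n. s n \<in> bounded_L1) \<and> (\<lambda>n. L2_norm (\<lambda>x. u x - s n x)) \<longlonglongrightarrow> 0"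
proof -
  have [measurable]: "u \<in> borel_measurable borel" using u by (simp add: L2_lborel_def)
  define E where "E n = {x. norm x \<le> real n \<and> cmod (u x) \<le> real n}" for n :: nat
  have [measurable]: "E n \<in> sets borel" for n unfolding E_def by measurable
  define s where "s n x = indicator (E n) x *\<^sub>R u x" for n x
  have [measurable]: "s n \<in> borel_measurable borel" for n unfolding s_def[abs_def] by measurable
  have sb: "cmod (s n x) \<le> real n" for n x
    by (auto simp: s_def E_def split: split_indicator)
  have "integrable lborel (s n)" for n
  proof (rule Bochner_Integration.integrable_bound)
    show "integrable lborel (\<lambda>x. real n * indicator (cball 0 (real n)) x)"
      by (intro integrable_mult_right integrable_real_indicator emeasure_bounded_finite) auto
    show "AE x in lborel. norm (s n x) \<le> norm (real n * indicator (cball 0 (real n)) x :: real)"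
      by (auto simp: s_def E_def split: split_indicator)
  qed measurable
  then have "s n \<in> bounded_L1" for n using sb by (auto simp: bounded_L1_def)
  moreover have "(\<lambda>n. L2_norm (\<lambda>x. u x - s n x)) \<longlonglongrightarrow> 0"
  proof -
    have "(\<lambda>n. LINT x|lborel. (cmod (u x - s n x))\<^sup>2) \<longlonglongrightarrow> (LINT x|(lborel :: (real^'a) measure). (0::real))"
    proof (rule integral_dominated_convergence[where w = "\<lambda>x. (cmod (u x))\<^sup>2"])
      show "integrable lborel (\<lambda>x. (cmod (u x))\<^sup>2)" using u by (rule L2_lborel_integrable)
      show "AE x in lborel. norm ((cmod (u x - s n x))\<^sup>2) \<le> (cmod (u x))\<^sup>2" for n
        by (auto simp: s_def split: split_indicator)
      show "AE x in lborel. (\<lambda>n. (cmod (u x - s n x))\<^sup>2) \<longlonglongrightarrow> 0"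
      proof (intro AE_I2 tendsto_eventually)
        fix x
        obtain N where N: "norm x \<le> real N" "cmod (u x) \<le> real N"
          using real_arch_simple[of "max (norm x) (cmod (u x))"] by auto
        then have "(cmod (u x - s n x))\<^sup>2 = 0" if "n \<ge> N" for n
          using that by (auto simp: s_def E_def split: split_indicator)
        then show "\<forall>\<^sub>F n in sequentially. (cmod (u x - s n x))\<^sup>2 = 0"
          by (auto simp: eventually_sequentially)
      qed
    qed measurable
    then have "(\<lambda>n. (L2_norm (\<lambda>x. u x - s n x))\<^sup>2) \<longlonglongrightarrow> 0"
      by (simp add: L2_norm_square)
    then have "(\<lambda>n. sqrt ((L2_norm (\<lambda>x. u x - s n x))\<^sup>2)) \<longlonglongrightarrow> sqrt 0"
      by (intro tendsto_intros)
    then show ?thesis by simp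
  qed
  ultimately show ?thesis by blast
qed

text \<open>Coefficients of either sign let one statement encode an inequality between two sums. On
  \<open>bounded_L1\<close> Plancherel turns the sum into the integral of a nonnegative function,
  and each norm is continuous along an L2-approximating sequence.\<close>

lemma multiplier_sum_nonneg:
  fixes T :: "'j \<Rightarrow> (real ^ 'd \<Rightarrow> complex) \<Rightarrow> (real ^ 'd \<Rightarrow> complex)"
  assumes T: "\<And>j. j \<in> J \<Longrightarrow> fourier_multiplier (T j) (m j)"
    and pos: "\<And>\<xi>. 0 \<le> (\<Sum>j\<in>J. \<alpha> j * (cmod (m j \<xi>))\<^sup>2)"
    and u: "u \<in> L2_lborel"
  shows "0 \<le> (\<Sum>j\<in>J. \<alpha> j * (L2_norm (T j u))\<^sup>2)"
proof -
  obtain s where s: "\<And>n. s n \<in> bounded_L1" and lim: "(\<lambda>n. L2_norm (\<lambda>x. u x - s n x)) \<longlonglongrightarrow> 0"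
    using bounded_L1_dense[OF u] by blast
  have sL: "s n \<in> L2_lborel" for n using s by (rule bounded_L1_subset_L2_lborel)
  have "0 \<le> (\<Sum>j\<in>J. \<alpha> j * (L2_norm (T j (s n)))\<^sup>2)" for n
  proof -
    have "(\<Sum>j\<in>J. \<alpha> j * (L2_norm (T j (s n)))\<^sup>2)
      = (\<Sum>j\<in>J. (LINT \<xi>|lborel. \<alpha> j * ((cmod (m j \<xi>))\<^sup>2 * (cmod (fourier (s n) \<xi>))\<^sup>2)))"
      using L2_norm_multiplier(2)[OF T s] by simp
    also have "\<dots> = (LINT \<xi>|lborel. (\<Sum>j\<in>J. \<alpha> j * ((cmod (m j \<xi>))\<^sup>2 * (cmod (fourier (s n) \<xi>))\<^sup>2)))"
      by (rule Bochner_Integration.integral_sum[symmetric]) (intro integrable_mult_right L2_norm_multiplier(1)[OF T s])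
    also have "\<dots> = (LINT \<xi>|lborel. (\<Sum>j\<in>J. \<alpha> j * (cmod (m j \<xi>))\<^sup>2) * (cmod (fourier (s n) \<xi>))\<^sup>2)"
      by (simp add: sum_distrib_right mult.assoc)
    also have "\<dots> \<ge> 0"
      by (intro Bochner_Integration.integral_nonneg mult_nonneg_nonneg pos) simp
    finally show ?thesis .
  qed
  moreover have "(\<lambda>n. \<Sum>j\<in>J. \<alpha> j * (L2_norm (T j (s n)))\<^sup>2) \<longlonglongrightarrow> (\<Sum>j\<in>J. \<alpha> j * (L2_norm (T j u))\<^sup>2)"
  proof (intro tendsto_intros)
    fix j assume "j \<in> J"
    note Tj = T[OF this, unfolded fourier_multiplier_def]
    obtain C where C: "\<And>u. u \<in> L2_lborel \<Longrightarrow> L2_norm (T j u) \<le> C * L2_norm u"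
      using Tj by blast
    have "norm (L2_norm (T j (s n)) - L2_norm (T j u)) \<le> C * L2_norm (\<lambda>x. u x - s n x)" for n
    proof -
      have "norm (L2_norm (T j (s n)) - L2_norm (T j u)) \<le> L2_norm (\<lambda>x. T j u x - T j (s n) x)"
        using L2_norm_diff_abs[of "T j u" "T j (s n)"] Tj u sL by auto
      also have "(\<lambda>x. T j u x - T j (s n) x) = T j (\<lambda>x. u x - s n x)"
        using Tj u sL by simp
      also have "L2_norm \<dots> \<le> C * L2_norm (\<lambda>x. u x - s n x)"
        by (intro C L2_lborel_diff u sL)
      finally show ?thesis .
    qed
    then have "(\<lambda>n. L2_norm (T j (s n)) - L2_norm (T j u)) \<longlonglongrightarrow> 0"
      by (intro Lim_null_comparison[OF always_eventually tendsto_mult_right_zero[OF lim]]) auto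
    then show "(\<lambda>n. L2_norm (T j (s n))) \<longlonglongrightarrow> L2_norm (T j u)"
      by (rule LIM_zero_cancel)
  qed
  ultimately show ?thesis
    by (intro LIMSEQ_le_const) auto
qed

section \<open>A nonnegative kernel with compactly supported Fourier transform\<close>

lemma infnorm_le_iff_cart: "infnorm (x :: real ^ 'd) \<le> s \<longleftrightarrow> (\<forall>i. \<bar>x $ i\<bar> \<le> s)"
proof
  assume "\<forall>i. \<bar>x $ i\<bar> \<le> s"
  then show "infnorm x \<le> s"
    unfolding infnorm_cart by (intro cSup_least) auto
qed (use component_le_infnorm_cart[of x] in \<open>auto intro: order_trans\<close>)

lemma emeasure_centered_cube:
  assumes "0 \<le> s"
  shows "emeasure lborel (cbox (\<chi> i. - s) (\<chi> i. s) :: (real ^ 'd) set) = ennreal ((2 * s) ^ CARD('d))"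
proof -
  have "cbox (\<chi> i. - s) (\<chi> i. s :: real ^ 'd) \<noteq> {}"
    using assms by (auto simp: interval_ne_empty_cart)
  then have "measure lborel (cbox (\<chi> i. - s) (\<chi> i. s) :: (real ^ 'd) set) = (2 * s) ^ CARD('d)"
    by (simp add: content_cbox_cart)
  then show ?thesis
    using emeasure_lborel_cbox_finite[of "\<chi> i. - s" "(\<chi> i. s) :: real ^ 'd"]
    by (subst emeasure_eq_ennreal_measure) auto
qed

text \<open>The kernel is the normalised power spectrum of the indicator of a cube of side length \<open>r\<close>:
  it is nonnegative, and by inversion its Fourier transform is the normalised autocorrelation of the
  indicator.\<close>

lemma bump_kernel:
  assumes r: "r > 0"
  obtains \<phi> :: "real ^ 'd \<Rightarrow> real" where
    "\<And>x. 0 \<le> \<phi> x"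
    "integrable lborel (\<lambda>x. complex_of_real (\<phi> x))"
    "(\<lambda>x. complex_of_real (\<phi> x)) \<in> L2_lborel"
    "\<And>\<xi>. cmod (fourier (\<lambda>x. complex_of_real (\<phi> x)) \<xi>) \<le> 1"
    "\<And>\<xi>. r < infnorm \<xi> \<Longrightarrow> fourier (\<lambda>x. complex_of_real (\<phi> x)) \<xi> = 0"
    "\<And>\<xi> t. infnorm \<xi> \<le> t \<Longrightarrow> t \<le> r / 2 \<Longrightarrow> (1 - 2 * t / r) ^ CARD('d) \<le> cmod (fourier (\<lambda>x. complex_of_real (\<phi> x)) \<xi>)"
proof -
  define Q :: "real \<Rightarrow> (real ^ 'd) set" where "Q s = cbox (\<chi> i. - s) (\<chi> i. s)" for s
  have Q_iff: "x \<in> Q s \<longleftrightarrow> (\<forall>i. \<bar>x $ i\<bar> \<le> s)" for x s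
    by (auto simp: Q_def mem_box_cart abs_le_iff minus_le_iff)
  have emQ: "emeasure lborel (Q s) = ennreal ((2 * s) ^ CARD('d))" if "0 \<le> s" for s
    unfolding Q_def by (rule emeasure_centered_cube[OF that])
  have [measurable]: "Q s \<in> sets borel" for s by (simp add: Q_def)
  define v :: "real ^ 'd \<Rightarrow> complex" where "v = indicator (Q (r / 2))"
  have v: "v \<in> bounded_L1"
  proof -
    have "integrable lborel (indicator (Q (r / 2)) :: _ \<Rightarrow> real)"
      using r by (intro integrable_real_indicator) (auto simp: emQ)
    then have "integrable lborel (\<lambda>x. complex_of_real (indicator (Q (r / 2)) x))"
      by (rule integrable_of_real)
    moreover have "(\<lambda>x. complex_of_real (indicator (Q (r / 2)) x)) = v"
      by (auto simp: v_def split: split_indicator)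
    ultimately have "integrable lborel v" by simp
    then show ?thesis by (auto simp: bounded_L1_def v_def indicator_def intro!: exI[of _ 1])
  qed
  \<comment> \<open>The divisor is the volume of the cube, so that the transform of
    \<open>\<phi>\<close> is 1 at the origin.\<close>
  define \<phi> where "\<phi> y = (cmod (fourier v y))\<^sup>2 / r ^ CARD('d)" for y
  \<comment> \<open>The intersection of the cube with its translate by - \<xi>; its measure is the
    autocorrelation of the indicator.\<close>
  define E where "E \<xi> = {x \<in> Q (r / 2). x + \<xi> \<in> Q (r / 2)}" for \<xi>
  have [measurable]: "E \<xi> \<in> sets borel" for \<xi> unfolding E_def by measurable
  have int: "integrable lborel \<phi>"
    unfolding \<phi>_def[abs_def] by (intro integrable_divide integrable_fourier_square v)
  have F: "fourier (\<lambda>x. complex_of_real (\<phi> x)) \<xi> = complex_of_real (measure lborel (E \<xi>) / r ^ CARD('d))" for \<xi>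
  proof -
    have [measurable]: "\<phi> \<in> borel_measurable borel" using int by auto
    have "fourier (\<lambda>x. complex_of_real (\<phi> x)) \<xi>
      = (LINT y|lborel. complex_of_real ((cmod (fourier v y))\<^sup>2) * cis (2 * pi * ((- \<xi>) \<bullet> y)) / complex_of_real (r ^ CARD('d)))"
      by (subst fourier_lborel, measurable) (simp add: \<phi>_def inner_commute)
    also have "\<dots> = (LINT x|lborel. v x * cnj (v (x - (- \<xi>)))) / complex_of_real (r ^ CARD('d))"
      by (simp only: Bochner_Integration.integral_divide_zero inverse_fourier_square[OF v])
    also have "(LINT x|lborel. v x * cnj (v (x - (- \<xi>)))) = (LINT x|lborel. complex_of_real (indicator (E \<xi>) x))"
      by (intro Bochner_Integration.integral_cong refl) (auto simp: v_def E_def split: split_indicator)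
    also have "\<dots> = complex_of_real (measure lborel (E \<xi>))"
      by simp
    finally show ?thesis by simp
  qed
  have Esub: "E \<xi> \<subseteq> Q (r / 2)" for \<xi> by (auto simp: E_def)
  have mQ: "measure lborel (Q s) = (2 * s) ^ CARD('d)" if "0 \<le> s" for s
    using emQ[OF that] that by (simp add: measure_def)
  have fQ: "Q s \<in> fmeasurable lborel" for s
    unfolding Q_def using emeasure_lborel_cbox_finite by (intro fmeasurableI) auto
  have fE: "E \<xi> \<in> fmeasurable lborel" for \<xi>
    by (rule fmeasurableI2[OF fQ Esub]) simp
  show thesis
  proof
    show "0 \<le> \<phi> x" for x using r by (simp add: \<phi>_def)
    show i: "integrable lborel (\<lambda>x. complex_of_real (\<phi> x))" using int by (rule integrable_of_real)
    have "integrable lborel v" using v by (simp add: bounded_L1_def)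
    then have "(cmod (fourier v x))\<^sup>2 \<le> (LINT x|lborel. cmod (v x))\<^sup>2" for x
      by (intro power_mono fourier_norm_le) auto
    then have "\<bar>\<phi> x\<bar> \<le> (LINT x|lborel. cmod (v x))\<^sup>2 / r ^ CARD('d)" for x
      using r unfolding \<phi>_def by (simp add: divide_right_mono)
    then have "(\<lambda>x. complex_of_real (\<phi> x)) \<in> bounded_L1"
      using i by (auto simp: bounded_L1_def)
    then show "(\<lambda>x. complex_of_real (\<phi> x)) \<in> L2_lborel"
      by (rule bounded_L1_subset_L2_lborel)
    have "measure lborel (E \<xi>) \<le> measure lborel (Q (r / 2))" for \<xi>
      by (rule measure_mono_fmeasurable[OF Esub _ fQ]) simp
    then show "cmod (fourier (\<lambda>x. complex_of_real (\<phi> x)) \<xi>) \<le> 1" for \<xi>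
      using r by (simp add: F mQ norm_divide norm_power)
    show "fourier (\<lambda>x. complex_of_real (\<phi> x)) \<xi> = 0" if r_less: "r < infnorm \<xi>" for \<xi>
    proof -
      obtain i where i: "r < \<bar>\<xi> $ i\<bar>"
        using r_less infnorm_le_iff_cart[of \<xi> r] by (auto simp: not_le)
      have "E \<xi> = {}"
      proof (rule ccontr)
        assume "E \<xi> \<noteq> {}"
        then obtain x where "\<bar>x $ i\<bar> \<le> r / 2" "\<bar>(x + \<xi>) $ i\<bar> \<le> r / 2"
          by (auto simp: E_def Q_iff simp del: vector_add_component)
        with i show False unfolding vector_add_component by linarith
      qed
      then show ?thesis by (simp add: F)
    qed
    show "(1 - 2 * t / r) ^ CARD('d) \<le> cmod (fourier (\<lambda>x. complex_of_real (\<phi> x)) \<xi>)"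
      if t: "infnorm \<xi> \<le> t" "t \<le> r / 2" for \<xi> t
    proof -
      have t0: "0 \<le> t" using infnorm_pos_le[of \<xi>] t by simp
      have \<xi>: "\<bar>\<xi> $ i\<bar> \<le> t" for i using component_le_infnorm_cart[of \<xi> i] t by simp
      \<comment> \<open>A shift by at most t in each coordinate keeps the cube shrunk by t inside
        the original one. The ratio of volumes is the claimed bound.\<close>
      have "Q (r / 2 - t) \<subseteq> E \<xi>"
      proof
        fix x assume "x \<in> Q (r / 2 - t)"
        then have x: "\<bar>x $ i\<bar> \<le> r / 2 - t" for i by (simp add: Q_iff)
        have "\<bar>x $ i\<bar> \<le> r / 2" "\<bar>(x + \<xi>) $ i\<bar> \<le> r / 2" for i
          using x[of i] \<xi>[of i] t0 unfolding vector_add_component by linarith+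
        then show "x \<in> E \<xi>" by (simp add: E_def Q_iff)
      qed
      then have "measure lborel (Q (r / 2 - t)) \<le> measure lborel (E \<xi>)"
        by (rule measure_mono_fmeasurable) (auto intro: fE)
      then have "(r - 2 * t) ^ CARD('d) / r ^ CARD('d) \<le> measure lborel (E \<xi>) / r ^ CARD('d)"
        using t r by (intro divide_right_mono) (auto simp: mQ right_diff_distrib)
      moreover have "1 - 2 * t / r = (r - 2 * t) / r" using r by (simp add: field_simps)
      ultimately show ?thesis
        using r by (simp add: F power_divide norm_divide norm_power)
    qed
  qed
qed

section \<open>Modulations, supports, coverings and finite partial sums\<close>

lemma fourier_modulation:
  assumes [measurable]: "f \<in> borel_measurable borel"
  shows "fourier (\<lambda>x. f x * cis (2 * pi * (a \<bullet> x))) \<xi> = fourier f (\<xi> - a)"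
proof -
  have "cis (2 * pi * (a \<bullet> x)) * cis (- (2 * pi * (x \<bullet> \<xi>))) = cis (- (2 * pi * (x \<bullet> (\<xi> - a))))" for x
    by (simp add: cis_mult inner_diff_right inner_commute algebra_simps)
  then show ?thesis
    by (simp add: fourier_lborel mult.assoc)
qed

text \<open>By continuity g is nonzero on a nonempty open set around \<xi>, and such a set is never
  null. A covering of the essential support thus covers every frequency where the symbol is
  nonzero.\<close>

lemma ess_support_contains:
  assumes cont: "continuous_on UNIV g" and \<xi>: "g \<xi> \<noteq> 0"
  shows "\<xi> \<in> ess_support g"
proof (rule ccontr)
  assume "\<xi> \<notin> ess_support g"
  then obtain U where U: "open U" "\<xi> \<in> U" "AE x in lebesgue. x \<in> U \<longrightarrow> g x = 0"
    by (auto simp: ess_support_def)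
  let ?V = "U \<inter> {x. g x \<noteq> 0}"
  have "open ?V"
    by (intro open_Int U open_Collect_neq cont continuous_intros)
  moreover have "?V \<noteq> {}" using U \<xi> by auto
  ultimately have "\<not> negligible ?V" by (rule open_not_negligible)
  moreover have "?V \<in> null_sets lebesgue"
    using U(3) \<open>open ?V\<close> by (subst AE_iff_null_sets) (auto elim!: eventually_mono)
  ultimately show False by (simp add: negligible_iff_null_sets)
qed

text \<open>Along a connected set, \<open>y \<mapsto> |y - e|\<close> takes all values between \<open>0\<close> and its supremum; one cube
  contains at most one point of each of the shells \<open>|y - e| = 2 * R * k\<close>.\<close>

lemma connected_cubes_subset_cube:
  fixes E :: "(real ^ 'd) set"
  assumes conn: "connected E" and R: "R > 0" and cov: "E \<subseteq> (\<Union>i<N. cube R (x i))"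
  shows "\<exists>e. E \<subseteq> cube (2 * R * real N) e"
proof (cases "E = {}")
  case False
  then obtain e where e: "e \<in> E" by auto
  define f where "f y = infnorm (y - e)" for y
  have "continuous_on E f"
    unfolding f_def[abs_def] by (intro continuous_on_infnorm continuous_intros)
  then have "connected (f ` E)"
    using conn by (rule connected_continuous_image)
  then have iv: "t \<in> f ` E" if "y \<in> E" "0 \<le> t" "t \<le> f y" for y t
    using that e by (auto simp: connected_iff_interval f_def infnorm_0 image_iff)
  have "E \<subseteq> cube (2 * R * real N) e"
  proof
    fix y assume y: "y \<in> E"
    show "y \<in> cube (2 * R * real N) e"
    proof (rule ccontr)
      assume "y \<notin> cube (2 * R * real N) e"
      then have fy: "2 * R * real N \<le> f y" by (simp add: cube_def f_def)
      \<comment> \<open>Shell k = 0 is included, so there are N + 1 points for N cubes, which forces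
        two of them into the same cube. Their distance is strictly below 2 R, while different shells
        differ by at least 2 R.\<close>
      have "\<exists>z\<in>E. f z = 2 * R * real k" if "k \<le> N" for k
      proof -
        have "2 * R * real k \<le> f y"
          using that R fy by (intro order_trans[OF _ fy]) (auto intro!: mult_left_mono)
        then show ?thesis using iv[OF y, of "2 * R * real k"] R by (auto simp: image_iff)
      qed
      then obtain z where z: "\<And>k. k \<le> N \<Longrightarrow> z k \<in> E" "\<And>k. k \<le> N \<Longrightarrow> f (z k) = 2 * R * real k"
        by metis
      have "\<exists>i<N. z k \<in> cube R (x i)" if "k \<le> N" for k
        using z(1)[OF that] cov by auto
      then obtain i where i: "\<And>k. k \<le> N \<Longrightarrow> i k < N" "\<And>k. k \<le> N \<Longrightarrow> z k \<in> cube R (x (i k))"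
        by metis
      have "\<not> inj_on i {..N}"
        using pigeonhole[of i "{..N}"] card_mono[of "{..<N}" "i ` {..N}"] i(1) by fastforce
      then obtain k l where kl: "k \<le> N" "l \<le> N" "k \<noteq> l" "i k = i l"
        by (auto simp: inj_on_def)
      have "infnorm (z k - z l) < 2 * R"
      proof -
        have "infnorm (z k - z l) \<le> infnorm (z k - x (i k)) + infnorm (x (i k) - z l)"
          using infnorm_triangle[of "z k - x (i k)" "x (i k) - z l"] by simp
        also have "\<dots> < R + R"
          using i(2)[OF kl(1)] i(2)[OF kl(2)] kl(4) by (intro add_strict_mono) (auto simp: cube_def infnorm_sub)
        finally show ?thesis by simp
      qed
      moreover have "\<bar>f (z k) - f (z l)\<bar> \<le> infnorm (z k - z l)"
        using absdiff_infnorm[of "z k - e" "z l - e"] by (simp add: f_def)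
      moreover have "\<bar>f (z k) - f (z l)\<bar> = 2 * R * \<bar>real k - real l\<bar>"
        using z(2) kl R by (simp add: abs_mult flip: right_diff_distrib)
      moreover have "\<bar>real k - real l\<bar> \<ge> 1" using kl(3) by linarith
      then have "2 * R * \<bar>real k - real l\<bar> \<ge> 2 * R * 1" using R by (intro mult_left_mono) auto
      ultimately show False by linarith
    qed
  qed
  then show ?thesis by blast
qed auto

text \<open>Dini-type compactness: each point has a finite partial sum above \<delta>, and by
  continuity this persists nearby. Since all terms are nonnegative, the union of the finitely many
  index sets of a subcover serves every point of K.\<close>

lemma infsum_compact_finite:
  fixes h :: "'a::topological_space \<Rightarrow> real" and g :: "'p \<Rightarrow> 'a \<Rightarrow> real"
  assumes K: "compact K" and h: "continuous_on UNIV h"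
    and g: "\<And>q. q \<in> A \<Longrightarrow> continuous_on UNIV (g q)" "\<And>q \<xi>. 0 \<le> g q \<xi>"
    and sum: "\<And>\<xi>. \<xi> \<in> K \<Longrightarrow> (\<lambda>q. g q \<xi>) summable_on A" "\<And>\<xi>. \<xi> \<in> K \<Longrightarrow> \<delta> < h \<xi> + (\<Sum>\<^sub>\<infinity>q\<in>A. g q \<xi>)"
  shows "\<exists>S. finite S \<and> S \<subseteq> A \<and> (\<forall>\<xi>\<in>K. \<delta> < h \<xi> + (\<Sum>q\<in>S. g q \<xi>))"
proof -
  define U where "U S = {\<xi>. \<delta> < h \<xi> + (\<Sum>q\<in>S. g q \<xi>)}" for S
  have "\<exists>S. finite S \<and> S \<subseteq> A \<and> \<xi> \<in> U S" if "\<xi> \<in> K" for \<xi>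
  proof -
    have "(sum (\<lambda>q. g q \<xi>) \<longlongrightarrow> (\<Sum>\<^sub>\<infinity>q\<in>A. g q \<xi>)) (finite_subsets_at_top A)"
      using has_sum_infsum[OF sum(1)[OF that]] by (simp add: has_sum_def)
    then have "\<forall>\<^sub>F S in finite_subsets_at_top A. \<delta> - h \<xi> < (\<Sum>q\<in>S. g q \<xi>)"
      using sum(2)[OF that] by (intro order_tendstoD) auto
    then obtain S where "finite S" "S \<subseteq> A" "\<delta> - h \<xi> < (\<Sum>q\<in>S. g q \<xi>)"
      by (auto simp: eventually_finite_subsets_at_top)
    then show ?thesis by (auto simp: U_def algebra_simps)
  qed
  then have cov: "K \<subseteq> (\<Union>S\<in>{S. finite S \<and> S \<subseteq> A}. U S)" by auto
  have "open (U S)" if "S \<in> {S. finite S \<and> S \<subseteq> A}" for S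
    unfolding U_def using that by (intro open_Collect_less continuous_intros h g) auto
  from compactE_image[OF K this cov]
  obtain C where C: "C \<subseteq> {S. finite S \<and> S \<subseteq> A}" "finite C" "K \<subseteq> (\<Union>S\<in>C. U S)"
    by metis
  show ?thesis
  proof (intro exI[of _ "\<Union>C"] conjI ballI)
    show fin: "finite (\<Union>C)" "\<Union>C \<subseteq> A" using C by auto
    fix \<xi> assume "\<xi> \<in> K"
    then obtain S where "S \<in> C" "\<xi> \<in> U S" using C by auto
    moreover have "(\<Sum>q\<in>S. g q \<xi>) \<le> (\<Sum>q\<in>\<Union>C. g q \<xi>)"
      using \<open>S \<in> C\<close> fin by (intro sum_mono2 g) auto
    ultimately show "\<delta> < h \<xi> + (\<Sum>q\<in>\<Union>C. g q \<xi>)" by (auto simp: U_def)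
  qed
qed

text \<open>The difference of the two sides is a single signed sum over the disjoint union of the
  index sets, to which \<open>multiplier_sum_nonneg\<close> applies.\<close>

lemma multiplier_sum_le:
  fixes S :: "'i \<Rightarrow> (real ^ 'd \<Rightarrow> complex) \<Rightarrow> (real ^ 'd \<Rightarrow> complex)"
    and T :: "'j \<Rightarrow> (real ^ 'd \<Rightarrow> complex) \<Rightarrow> (real ^ 'd \<Rightarrow> complex)"
  assumes fin: "finite I" "finite J"
    and S: "\<And>i. i \<in> I \<Longrightarrow> fourier_multiplier (S i) (k i)"
    and T: "\<And>j. j \<in> J \<Longrightarrow> fourier_multiplier (T j) (m j)"
    and le: "\<And>\<xi>. (\<Sum>i\<in>I. \<alpha> i * (cmod (k i \<xi>))\<^sup>2) \<le> (\<Sum>j\<in>J. \<beta> j * (cmod (m j \<xi>))\<^sup>2)"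
    and u: "u \<in> L2_lborel"
  shows "(\<Sum>i\<in>I. \<alpha> i * (L2_norm (S i u))\<^sup>2) \<le> (\<Sum>j\<in>J. \<beta> j * (L2_norm (T j u))\<^sup>2)"
proof -
  have plus: "(\<Sum>x\<in>I <+> J. case_sum (\<lambda>i. - \<alpha> i) \<beta> x * case_sum a b x) = (\<Sum>j\<in>J. \<beta> j * b j) - (\<Sum>i\<in>I. \<alpha> i * a i)"
    for a :: "'i \<Rightarrow> real" and b :: "'j \<Rightarrow> real"
    using fin by (simp add: sum.Plus sum_negf)
  have d: "(cmod (case_sum k m x \<xi>))\<^sup>2 = case_sum (\<lambda>i. (cmod (k i \<xi>))\<^sup>2) (\<lambda>j. (cmod (m j \<xi>))\<^sup>2) x"
    "(L2_norm (case_sum S T x u))\<^sup>2 = case_sum (\<lambda>i. (L2_norm (S i u))\<^sup>2) (\<lambda>j. (L2_norm (T j u))\<^sup>2) x" for x \<xi>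
    by (auto split: sum.split)
  have "0 \<le> (\<Sum>x\<in>I <+> J. case_sum (\<lambda>i. - \<alpha> i) \<beta> x * (L2_norm (case_sum S T x u))\<^sup>2)"
  proof (rule multiplier_sum_nonneg[OF _ _ u])
    show "fourier_multiplier (case_sum S T x) (case_sum k m x)" if "x \<in> I <+> J" for x
      using that S T by auto
    show "0 \<le> (\<Sum>x\<in>I <+> J. case_sum (\<lambda>i. - \<alpha> i) \<beta> x * (cmod (case_sum k m x \<xi>))\<^sup>2)" for \<xi>
      unfolding d plus using le[of \<xi>] by simp
  qed
  then show ?thesis unfolding d plus by simp
qed

section \<open>The lower frame bound\<close>

lemma L2_norm_modulus: "L2_norm (\<lambda>x. complex_of_real (cmod (v x))) = L2_norm v"
  by (simp add: L2_norm_def)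

lemma modulus_L2_lborel:
  assumes "v \<in> L2_lborel"
  shows "(\<lambda>x. complex_of_real (cmod (v x))) \<in> L2_lborel"
  using assms by (auto simp: L2_lborel_def)

text \<open>The modulus destroys the frequency localisation of \<open>v\<close>, but convolving \<open>|v|\<close> with a nonnegative
  kernel dominates the convolution of \<open>v\<close> with every modulation of that kernel.\<close>

lemma L2_norm_convolve_modulation_le:
  fixes \<phi> :: "real ^ 'd \<Rightarrow> real"
  assumes v: "v \<in> L2_lborel" and \<phi>: "\<And>x. 0 \<le> \<phi> x"
    "integrable lborel (\<lambda>x. complex_of_real (\<phi> x))" "(\<lambda>x. complex_of_real (\<phi> x)) \<in> L2_lborel"
  shows "(L2_norm (convolve v (\<lambda>x. complex_of_real (\<phi> x) * cis (2 * pi * (a \<bullet> x)))))\<^sup>2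
    \<le> (L2_norm (convolve (\<lambda>x. complex_of_real (cmod (v x))) (\<lambda>x. complex_of_real (\<phi> x))))\<^sup>2"
proof -
  let ?\<phi> = "\<lambda>x. complex_of_real (\<phi> x)" and ?g = "\<lambda>x. complex_of_real (cmod (v x))"
  let ?m = "\<lambda>x. ?\<phi> x * cis (2 * pi * (a \<bullet> x))"
  have g: "?g \<in> L2_lborel" using v by (rule modulus_L2_lborel)
  have [measurable]: "v \<in> borel_measurable borel" "?\<phi> \<in> borel_measurable borel" "?g \<in> borel_measurable borel"
    using v \<phi> g by (auto simp: L2_lborel_def)
  have mi: "integrable lborel ?m"
    by (intro integrable_mult_cis \<phi>) measurable
  have m[measurable]: "?m \<in> borel_measurable borel" by measurable
  have le: "cmod (convolve v ?m x) \<le> cmod (convolve ?g ?\<phi> x)" for x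
  proof -
    have "cmod (convolve v ?m x) \<le> (LINT y|lborel. cmod (v y * ?m (x - y)))"
      unfolding convolve_lborel[OF \<open>v \<in> borel_measurable borel\<close> m] by (rule integral_norm_bound)
    also have "\<dots> = (LINT y|lborel. cmod (v y) * \<phi> (x - y))"
      by (simp add: norm_mult \<phi>(1))
    also have "\<dots> \<le> cmod (complex_of_real (LINT y|lborel. cmod (v y) * \<phi> (x - y)))"
      by simp
    also have "complex_of_real (LINT y|lborel. cmod (v y) * \<phi> (x - y)) = convolve ?g ?\<phi> x"
      by (simp add: convolve_lborel flip: of_real_mult)
    finally show ?thesis .
  qed
  have "(LINT x|lborel. (cmod (convolve v ?m x))\<^sup>2) \<le> (LINT x|lborel. (cmod (convolve ?g ?\<phi> x))\<^sup>2)"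
    by (intro integral_mono L2_lborel_integrable convolve_L2_lborel v g mi \<phi> power_mono le norm_ge_zero)
  then show ?thesis
    by (simp add: L2_norm_square)
qed

text \<open>One layer: \<open>h\<close> is the incoming signal, \<open>fp\<close> its filter, and r
  is the radius of the cube on which the family over \<open>A\<close> is complete. The exponent is
  twice the dimension because the bound of the kernel at distance R, a d-th power, gets
  squared.\<close>

lemma frame_lower_bound:
  fixes f0 fp :: "real ^ 'd \<Rightarrow> complex" and F :: "'p \<Rightarrow> real ^ 'd \<Rightarrow> complex"
  assumes f0: "integrable lborel f0" "f0 \<in> L2_lborel"
    and fp: "integrable lborel fp" "fp \<in> L2_lborel"
    and F: "\<And>q. q \<in> A \<Longrightarrow> integrable lborel (F q)" "\<And>q. q \<in> A \<Longrightarrow> F q \<in> L2_lborel"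
    and summ: "\<And>\<xi>. (\<lambda>q. (cmod (fourier (F q) \<xi>))\<^sup>2) summable_on A"
    and le1: "\<And>\<xi>. (\<Sum>\<^sub>\<infinity>q\<in>A. (cmod (fourier (F q) \<xi>))\<^sup>2) \<le> 1"
    and eq1: "\<And>\<xi>. infnorm \<xi> \<le> r \<Longrightarrow> (cmod (fourier f0 \<xi>))\<^sup>2 + (\<Sum>\<^sub>\<infinity>q\<in>A. (cmod (fourier (F q) \<xi>))\<^sup>2) = 1"
    and h: "h \<in> L2_lborel"
    and cov: "ess_support (fourier fp) \<subseteq> (\<Union>i<N. cube R (x i))"
    and R: "0 < R" "2 * R \<le> r" and N: "0 < N"
  defines "g \<equiv> \<lambda>x. complex_of_real (cmod (convolve h fp x))"
  shows "(1 - 2 * R / r) ^ (2 * CARD('d)) / real N * (L2_norm g)\<^sup>2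
    \<le> (L2_norm (convolve g f0))\<^sup>2 + (\<Sum>\<^sub>\<infinity>q\<in>A. (L2_norm (convolve g (F q)))\<^sup>2)"
proof -
  have r: "r > 0" using R by simp
  obtain \<phi> :: "real ^ 'd \<Rightarrow> real" where \<phi>0: "\<And>x. 0 \<le> \<phi> x"
    and \<phi>i: "integrable lborel (\<lambda>x. complex_of_real (\<phi> x))"
    and \<phi>2: "(\<lambda>x. complex_of_real (\<phi> x)) \<in> L2_lborel"
    and \<phi>1: "\<And>\<xi>. cmod (fourier (\<lambda>x. complex_of_real (\<phi> x)) \<xi>) \<le> 1"
    and \<phi>s: "\<And>\<xi>. r < infnorm \<xi> \<Longrightarrow> fourier (\<lambda>x. complex_of_real (\<phi> x)) \<xi> = 0"
    and \<phi>l: "\<And>\<xi> t. infnorm \<xi> \<le> t \<Longrightarrow> t \<le> r / 2 \<Longrightarrow>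
        (1 - 2 * t / r) ^ CARD('d) \<le> cmod (fourier (\<lambda>x. complex_of_real (\<phi> x)) \<xi>)"
    using bump_kernel[OF r] by metis
  define \<psi> where "\<psi> = (\<lambda>x. complex_of_real (\<phi> x))"
  note \<phi> = \<phi>0 \<phi>i[folded \<psi>_def] \<phi>2[folded \<psi>_def] \<phi>1[folded \<psi>_def] \<phi>s[folded \<psi>_def] \<phi>l[folded \<psi>_def]
  define v where "v = convolve h fp"
  have v: "v \<in> L2_lborel" unfolding v_def by (rule convolve_L2_lborel[OF h fp(1)])
  have g_eq: "g = (\<lambda>x. complex_of_real (cmod (v x)))" by (simp add: g_def v_def)
  have g: "g \<in> L2_lborel" unfolding g_eq by (rule modulus_L2_lborel[OF v])
  have g_norm: "L2_norm g = L2_norm v" unfolding g_eq by (rule L2_norm_modulus)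
  define \<kappa> where "\<kappa> = (1 - 2 * R / r) ^ (2 * CARD('d))"
  have \<kappa>: "0 \<le> \<kappa>" unfolding \<kappa>_def by (simp add: power_mult)
  define \<psi>m where "\<psi>m i y = \<psi> y * cis (2 * pi * (x i \<bullet> y))" for i y
  have [measurable]: "\<psi> \<in> borel_measurable borel" using \<phi>(3) by (simp add: L2_lborel_def)
  have \<psi>mi: "integrable lborel (\<psi>m i)" for i
    unfolding \<psi>m_def[abs_def] by (intro integrable_mult_cis \<phi>) measurable
  have \<psi>m2: "\<psi>m i \<in> L2_lborel" for i
    using \<phi>(3) unfolding \<psi>m_def[abs_def] L2_lborel_def by (auto simp: norm_mult)
  have \<psi>mf: "fourier (\<psi>m i) \<xi> = fourier \<psi> (\<xi> - x i)" for i \<xi>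
    unfolding \<psi>m_def[abs_def] by (rule fourier_modulation) measurable

  \<comment> \<open>The comparison is made between operators acting on \<open>h\<close>, so both
    symbols contain the factor \<open>fourier fp\<close>. Where it vanishes there is nothing to
    prove; elsewhere the frequency lies in some cube, and the kernel modulated to its centre is
    large there. The one-point index set only casts the left side as a sum.\<close>
  have "(\<Sum>_\<in>{()}. \<kappa> * (L2_norm (convolve h fp))\<^sup>2)
      \<le> (\<Sum>i<N. 1 * (L2_norm (convolve (convolve h fp) (\<psi>m i)))\<^sup>2)"
  proof (rule multiplier_sum_le[where u = h and S = "\<lambda>_ u. convolve u fp" and T = "\<lambda>i u. convolve (convolve u fp) (\<psi>m i)"
        and k = "\<lambda>_. fourier fp" and m = "\<lambda>i \<xi>. fourier (\<psi>m i) \<xi> * fourier fp \<xi>"])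
    show "fourier_multiplier (\<lambda>u. convolve u fp) (fourier fp)"
      by (rule fourier_multiplier_convolve[OF fp])
    then show "fourier_multiplier (\<lambda>u. convolve (convolve u fp) (\<psi>m i)) (\<lambda>\<xi>. fourier (\<psi>m i) \<xi> * fourier fp \<xi>)" for i
      by (rule fourier_multiplier_compose) (rule fourier_multiplier_convolve[OF \<psi>mi \<psi>m2])
    fix \<xi>
    show "(\<Sum>_\<in>{()}. \<kappa> * (cmod (fourier fp \<xi>))\<^sup>2) \<le> (\<Sum>i<N. 1 * (cmod (fourier (\<psi>m i) \<xi> * fourier fp \<xi>))\<^sup>2)"
    proof (cases "fourier fp \<xi> = 0")
      case False
      then have "\<xi> \<in> ess_support (fourier fp)"
        by (intro ess_support_contains continuous_fourier fp)
      then obtain i where i: "i < N" "infnorm (\<xi> - x i) < R"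
        using cov by (auto simp: cube_def)
      have "(1 - 2 * R / r) ^ CARD('d) \<le> cmod (fourier (\<psi>m i) \<xi>)"
        unfolding \<psi>mf using i R by (intro \<phi>) auto
      then have "((1 - 2 * R / r) ^ CARD('d))\<^sup>2 \<le> (cmod (fourier (\<psi>m i) \<xi>))\<^sup>2"
        using R r by (intro power_mono) auto
      then have "\<kappa> * (cmod (fourier fp \<xi>))\<^sup>2 \<le> (cmod (fourier (\<psi>m i) \<xi>))\<^sup>2 * (cmod (fourier fp \<xi>))\<^sup>2"
        unfolding \<kappa>_def by (intro mult_right_mono) (auto simp: power_mult[symmetric] mult.commute)
      also have "\<dots> = (cmod (fourier (\<psi>m i) \<xi> * fourier fp \<xi>))\<^sup>2"
        by (simp add: norm_mult power_mult_distrib)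
      also have "\<dots> \<le> (\<Sum>i<N. (cmod (fourier (\<psi>m i) \<xi> * fourier fp \<xi>))\<^sup>2)"
        using i by (intro member_le_sum) auto
      finally show ?thesis by simp
    qed simp
  qed (auto intro: h)
  then have "\<kappa> * (L2_norm v)\<^sup>2 \<le> (\<Sum>i<N. (L2_norm (convolve v (\<psi>m i)))\<^sup>2)"
    by (simp add: v_def)
  also have "\<dots> \<le> (\<Sum>i<N. (L2_norm (convolve g \<psi>))\<^sup>2)"
    unfolding g_eq \<psi>m_def[abs_def] \<psi>_def
    by (intro sum_mono L2_norm_convolve_modulation_le v \<phi>0 \<phi>i \<phi>2)
  finally have B: "\<kappa> * (L2_norm g)\<^sup>2 \<le> real N * (L2_norm (convolve g \<psi>))\<^sup>2"
    by (simp add: g_norm)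

  let ?a = "\<lambda>q. (L2_norm (convolve g (F q)))\<^sup>2"
  \<comment> \<open>A Bessel bound uniform in the finite subset. It makes the energies summable over
    \<open>A\<close>, so that \<open>infsum\<close> is a genuine sum dominating its finite parts and
    not the default 0.\<close>
  have fin_le: "(\<Sum>q\<in>S. ?a q) \<le> (L2_norm g)\<^sup>2" if S: "finite S" "S \<subseteq> A" for S
  proof -
    have "(\<Sum>q\<in>S. 1 * ?a q) \<le> (\<Sum>_\<in>{()}. 1 * (L2_norm g)\<^sup>2)"
    proof (rule multiplier_sum_le[where u = g and S = "\<lambda>q u. convolve u (F q)" and T = "\<lambda>_ u. u"
          and k = "\<lambda>q. fourier (F q)" and m = "\<lambda>_ _. 1"])
      show "fourier_multiplier (\<lambda>u. convolve u (F q)) (fourier (F q))" if "q \<in> S" for q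
        using that S by (intro fourier_multiplier_convolve F) auto
      fix \<xi>
      have "(\<Sum>q\<in>S. (cmod (fourier (F q) \<xi>))\<^sup>2) \<le> (\<Sum>\<^sub>\<infinity>q\<in>A. (cmod (fourier (F q) \<xi>))\<^sup>2)"
        using S by (intro finite_sum_le_infsum summ) auto
      also note le1
      finally show "(\<Sum>q\<in>S. 1 * (cmod (fourier (F q) \<xi>))\<^sup>2) \<le> (\<Sum>_\<in>{()}. 1 * (cmod 1)\<^sup>2)" by simp
    qed (use S g fourier_multiplier_id in auto)
    then show ?thesis by simp
  qed
  have asum: "?a summable_on A"
    by (rule nonneg_bdd_above_summable_on) (auto intro!: bdd_aboveI2 fin_le)
  define V where "V = (L2_norm (convolve g f0))\<^sup>2 + (\<Sum>\<^sub>\<infinity>q\<in>A. ?a q)"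

  \<comment> \<open>A finite partial sum need not reach the value 1 on the cube, which forces
    \<delta> < 1 here.\<close>
  have A: "\<delta> * (L2_norm (convolve g \<psi>))\<^sup>2 \<le> V" if \<delta>: "0 < \<delta>" "\<delta> < 1" for \<delta>
  proof -
    have comp: "compact {\<xi> :: real ^ 'd. infnorm \<xi> \<le> r}"
    proof -
      have "{\<xi> :: real ^ 'd. infnorm \<xi> \<le> r} = cbox (\<chi> i. - r) (\<chi> i. r)"
        by (auto simp: infnorm_le_iff_cart mem_box_cart abs_le_iff minus_le_iff)
      then show ?thesis by simp
    qed
    have "\<exists>S. finite S \<and> S \<subseteq> A \<and> (\<forall>\<xi>\<in>{\<xi>. infnorm \<xi> \<le> r}.
        \<delta> < (cmod (fourier f0 \<xi>))\<^sup>2 + (\<Sum>q\<in>S. (cmod (fourier (F q) \<xi>))\<^sup>2))"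
    proof (rule infsum_compact_finite[OF comp])
      show "\<delta> < (cmod (fourier f0 \<xi>))\<^sup>2 + (\<Sum>\<^sub>\<infinity>q\<in>A. (cmod (fourier (F q) \<xi>))\<^sup>2)"
        if "\<xi> \<in> {\<xi>. infnorm \<xi> \<le> r}" for \<xi>
        using eq1[of \<xi>] that \<delta> by simp
    qed (auto intro!: continuous_intros continuous_fourier f0 F summ)
    then obtain S where S: "finite S" "S \<subseteq> A"
      and lt: "\<And>\<xi>. infnorm \<xi> \<le> r \<Longrightarrow> \<delta> < (cmod (fourier f0 \<xi>))\<^sup>2 + (\<Sum>q\<in>S. (cmod (fourier (F q) \<xi>))\<^sup>2)"
      by auto
    \<comment> \<open>\<open>None\<close> stands for \<open>f0\<close>, so that \<open>f0\<close>
      and the finitely many \<open>F q\<close> form one indexed family.\<close>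
    let ?T = "\<lambda>j u. case j of None \<Rightarrow> convolve u f0 | Some q \<Rightarrow> convolve u (F q)"
    let ?m = "\<lambda>j. case j of None \<Rightarrow> fourier f0 | Some q \<Rightarrow> fourier (F q)"
    have opt: "(\<Sum>j\<in>insert None (Some ` S). w j) = w None + (\<Sum>q\<in>S. w (Some q))" for w :: "'p option \<Rightarrow> real"
      using S by (simp add: sum.reindex)
    have "(\<Sum>_\<in>{()}. \<delta> * (L2_norm (convolve g \<psi>))\<^sup>2) \<le> (\<Sum>j\<in>insert None (Some ` S). 1 * (L2_norm (?T j g))\<^sup>2)"
    proof (rule multiplier_sum_le[where u = g and S = "\<lambda>_ u. convolve u \<psi>" and T = ?T
          and k = "\<lambda>_. fourier \<psi>" and m = ?m])
      show "fourier_multiplier (\<lambda>u. convolve u \<psi>) (fourier \<psi>)"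
        by (rule fourier_multiplier_convolve[OF \<phi>(2,3)])
      show "fourier_multiplier (?T j) (?m j)" if "j \<in> insert None (Some ` S)" for j
        using that S by (auto intro!: fourier_multiplier_convolve F f0)
      fix \<xi>
      show "(\<Sum>_\<in>{()}. \<delta> * (cmod (fourier \<psi> \<xi>))\<^sup>2) \<le> (\<Sum>j\<in>insert None (Some ` S). 1 * (cmod (?m j \<xi>))\<^sup>2)"
      \<comment> \<open>Inside the cube the kernel's transform is at most 1 in modulus and the
        partial sum exceeds \<delta>. Outside, the partial sum is not controlled from below, but the
        transform vanishes.\<close>
      proof (cases "infnorm \<xi> \<le> r")
        case True
        have "(cmod (fourier \<psi> \<xi>))\<^sup>2 \<le> 1" using \<phi>(4) by (simp add: power_le_one)
        then have "\<delta> * (cmod (fourier \<psi> \<xi>))\<^sup>2 \<le> \<delta>" using \<delta> by (simp add: mult_left_le)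
        with lt[OF True] show ?thesis unfolding opt by simp
      next
        case False
        then have "fourier \<psi> \<xi> = 0" by (intro \<phi>) simp
        then show ?thesis unfolding opt by (simp add: sum_nonneg)
      qed
    qed (use S g in auto)
    then have "\<delta> * (L2_norm (convolve g \<psi>))\<^sup>2 \<le> (L2_norm (convolve g f0))\<^sup>2 + (\<Sum>q\<in>S. ?a q)"
      unfolding opt by simp
    also have "(\<Sum>q\<in>S. ?a q) \<le> (\<Sum>\<^sub>\<infinity>q\<in>A. ?a q)"
      using S by (intro finite_sum_le_infsum asum) auto
    finally show ?thesis by (simp add: V_def)
  qed
  \<comment> \<open>The finite set depends on \<delta>, but \<open>V\<close> does not, so \<delta>
    may rise to 1.\<close>
  have "(L2_norm (convolve g \<psi>))\<^sup>2 \<le> V"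
  proof (rule tendsto_upperbound)
    show "((\<lambda>\<delta>. \<delta> * (L2_norm (convolve g \<psi>))\<^sup>2) \<longlongrightarrow> (L2_norm (convolve g \<psi>))\<^sup>2) (at_left 1)"
      by (auto intro!: tendsto_eq_intros)
    show "\<forall>\<^sub>F \<delta> in at_left 1. \<delta> * (L2_norm (convolve g \<psi>))\<^sup>2 \<le> V"
      using eventually_at_left_real[of 0 1] by (auto elim!: eventually_mono intro: A)
  qed simp
  then have "\<kappa> * (L2_norm g)\<^sup>2 \<le> real N * V"
    using B N by (smt (verit) mult_left_mono of_nat_0_le_iff)
  then show ?thesis
    using N unfolding V_def[symmetric] \<kappa>_def[symmetric] by (simp add: field_simps)
qed

section \<open>Borel representatives of the frame and of the propagated signals\<close>

lemma borel_version:
  fixes f :: "real ^ 'd \<Rightarrow> complex"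
  assumes f: "f \<in> borel_measurable lebesgue"
  obtains f' where "f' \<in> borel_measurable borel" "AE x in lborel. f x = f' x"
proof -
  have "(\<lambda>x. Re (f x)) \<in> borel_measurable lebesgue"
    using f by measurable
  then obtain a where a: "a \<in> borel_measurable lborel" "AE x in lborel. Re (f x) = a x"
    using completion_ex_borel_measurable_real by blast
  have "(\<lambda>x. Im (f x)) \<in> borel_measurable lebesgue"
    using f by measurable
  then obtain b where b: "b \<in> borel_measurable lborel" "AE x in lborel. Im (f x) = b x"
    using completion_ex_borel_measurable_real by blast
  show thesis
  proof
    show "(\<lambda>x. Complex (a x) (b x)) \<in> borel_measurable borel"
      using a b by (simp add: Complex_eq)
    show "AE x in lborel. f x = Complex (a x) (b x)"
      using a(2) b(2) by eventually_elim (simp add: complex_eq_iff)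
  qed
qed

lemma AE_reflect:
  assumes "AE y in lborel. P y"
  shows "AE y in lborel. P (t - y :: 'a::euclidean_space)"
proof -
  have "AE y in distr lborel borel (\<lambda>y. t - y). P y" by (subst lborel_reflect) (rule assms)
  then show ?thesis by (rule AE_distrD[rotated]) measurable
qed

lemma
  fixes f :: "real ^ 'd \<Rightarrow> complex"
  assumes f: "f \<in> borel_measurable lebesgue" and f': "f' \<in> borel_measurable borel"
    and eq: "AE x in lborel. f x = f' x"
  shows fourier_cong_AE: "fourier f = fourier f'"
    and L1_cong_AE: "f \<in> L1 \<Longrightarrow> integrable lborel f'"
    and L2_cong_AE: "f \<in> L2 \<Longrightarrow> f' \<in> L2_lborel"
proof -
  have eqL: "AE x in lebesgue. f x = f' x" using eq by (rule AE_completion)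
  have f'L: "f' \<in> borel_measurable lebesgue" using f' by (auto intro: measurable_completion)
  note [measurable] = f f'L
  show "fourier f = fourier f'"
  proof
    fix \<xi> :: "real ^ 'd"
    have e: "(\<lambda>x. exp (- 2 * pi * \<i> * complex_of_real (x \<bullet> \<xi>))) \<in> borel_measurable lebesgue"
      by (intro measurable_completion) measurable
    show "fourier f \<xi> = fourier f' \<xi>"
      unfolding fourier_def
    proof (rule integral_cong_AE)
      show "AE x in lebesgue. f x * exp (- 2 * pi * \<i> * complex_of_real (x \<bullet> \<xi>))
          = f' x * exp (- 2 * pi * \<i> * complex_of_real (x \<bullet> \<xi>))"
        using eqL by eventually_elim simp
    qed (rule borel_measurable_times[OF f e] borel_measurable_times[OF f'L e])+
  qed
  show "integrable lborel f'" if "f \<in> L1"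
  proof -
    have "integrable lebesgue f'"
      using that integrable_cong_AE[OF f f'L eqL] by (simp add: L1_def)
    then show ?thesis using f' by (subst (asm) integrable_completion) auto
  qed
  show "f' \<in> L2_lborel" if "f \<in> L2"
  proof -
    have "integrable lebesgue (\<lambda>x. (cmod (f x))\<^sup>2)" using that by (simp add: L2_def)
    moreover have "AE x in lebesgue. (cmod (f x))\<^sup>2 = (cmod (f' x))\<^sup>2"
      using eqL by eventually_elim simp
    ultimately have "integrable lebesgue (\<lambda>x. (cmod (f' x))\<^sup>2)"
      by (subst (asm) integrable_cong_AE) auto
    then show ?thesis using f' by (subst (asm) integrable_completion) (auto simp: L2_lborel_def)
  qed
qed

text \<open>Equality holds at every point and not only almost everywhere, because reflection and
  translation preserve null sets.\<close>

lemma convolve_cong_AE: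
  fixes f g :: "real ^ 'd \<Rightarrow> complex"
  assumes f: "f \<in> borel_measurable lebesgue" "f' \<in> borel_measurable borel" "AE x in lborel. f x = f' x"
    and g: "g \<in> borel_measurable lebesgue" "g' \<in> borel_measurable borel" "AE x in lborel. g x = g' x"
  shows "convolve f g = convolve f' g'"
proof
  fix x
  \<comment> \<open>\<open>g\<close> is only Lebesgue measurable, and composition with a continuous
    map need not preserve this. The reflection does, being an invertible affine map.\<close>
  have refl: "(\<lambda>y. x - y) \<in> lebesgue \<rightarrow>\<^sub>M (lebesgue :: (real ^ 'd) measure)"
    using lebesgue_affine_measurable[of "\<lambda>_. - 1" x] by (simp add: euclidean_representation sum_negf)
  have gx: "(\<lambda>y. g (x - y)) \<in> borel_measurable lebesgue"
    using measurable_compose[OF refl g(1)] .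
  have "f' \<in> borel_measurable lebesgue" "(\<lambda>y. g' (x - y)) \<in> borel_measurable lebesgue"
    using f(2) g(2) by (auto intro!: measurable_completion)
  moreover have "AE y in lebesgue. f y * g (x - y) = f' y * g' (x - y)"
  proof (rule AE_completion)
    show "AE y in lborel. f y * g (x - y) = f' y * g' (x - y)"
      using f(3) AE_reflect[OF g(3), of x] by eventually_elim simp
  qed
  ultimately show "convolve f g x = convolve f' g' x"
    unfolding convolve_def using f(1) gx by (intro integral_cong_AE) auto
qed

lemma propagator1_measurable:
  assumes "f \<in> borel_measurable borel" "F p \<in> borel_measurable borel"
  shows "propagator1 F p f \<in> borel_measurable borel"
  using convolve_measurable[OF assms] unfolding propagator1_def by measurable

text \<open>The first convolution already turns almost everywhere equality into equality. For the
  empty path nothing is convolved, hence the requirement that the path be nonempty.\<close>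

lemma propagator_cong_AE:
  assumes F: "\<And>p. p \<in> P \<Longrightarrow> F p \<in> borel_measurable lebesgue" "\<And>p. p \<in> P \<Longrightarrow> F' p \<in> borel_measurable borel"
      "\<And>p. p \<in> P \<Longrightarrow> AE x in lborel. F p x = F' p x"
    and f: "f \<in> borel_measurable lebesgue" "f' \<in> borel_measurable borel" "AE x in lborel. f x = f' x"
    and ps: "set ps \<subseteq> P" "ps \<noteq> []"
  shows "propagator F ps f = propagator F' ps f'"
  using f ps
proof (induction ps arbitrary: f f')
  case (Cons p ps)
  have p: "p \<in> P" and ps: "set ps \<subseteq> P" using Cons.prems by auto
  have step: "propagator1 F p f = propagator1 F' p f'"
    unfolding propagator1_def using convolve_cong_AE[OF Cons.prems(1-3) F[OF p]] by simp
  have m: "propagator1 F' p f' \<in> borel_measurable borel"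
    by (rule propagator1_measurable) (auto intro: Cons.prems F p)
  show ?case
  proof (cases "ps = []")
    case False
    have "propagator1 F' p f' \<in> borel_measurable lebesgue"
      using m by (intro measurable_completion) simp
    from Cons.IH[OF this m _ ps False] show ?thesis by (simp add: step)
  qed (simp add: step)
qed simp

lemma propagator_L2_lborel:
  assumes F: "\<And>p. p \<in> P \<Longrightarrow> integrable lborel (F p)" and f: "f \<in> L2_lborel" and ps: "set ps \<subseteq> P"
  shows "propagator F ps f \<in> L2_lborel"
  using f ps
proof (induction ps arbitrary: f)
  case (Cons p ps)
  then have "propagator1 F p f \<in> L2_lborel"
    unfolding propagator1_def by (intro modulus_L2_lborel convolve_L2_lborel F) auto
  with Cons show ?case by simp
qed simp

lemma propagator_append: "propagator F (ps @ qs) f = propagator F qs (propagator F ps f)"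
  by (induction ps arbitrary: f) auto

text \<open>Radial contraction approximates boundary points from inside. This makes the frame
  identity, stated on the closure, available wherever the sup norm is at most the radius.\<close>

lemma closure_cube:
  assumes "s > 0" "infnorm \<xi> \<le> s"
  shows "\<xi> \<in> closure (cube s 0)"
  unfolding closure_sequential
proof (intro exI[of _ "\<lambda>n. (1 - inverse (real (Suc n))) *\<^sub>R \<xi>"] conjI allI)
  show "(1 - inverse (real (Suc n))) *\<^sub>R \<xi> \<in> cube s 0" for n
  proof -
    have "0 < inverse (real (Suc n))" "inverse (real (Suc n)) \<le> 1" by (auto simp: inverse_le_1_iff)
    then have "(1 - inverse (real (Suc n))) * infnorm \<xi> \<le> (1 - inverse (real (Suc n))) * s"
      using assms by (intro mult_left_mono) auto
    also have "\<dots> < s" using assms \<open>0 < inverse (real (Suc n))\<close> by (simp add: left_diff_distrib)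
    finally show ?thesis
      using \<open>inverse (real (Suc n)) \<le> 1\<close> by (simp add: cube_def infnorm_mul)
  qed
  have "(\<lambda>n. (1 - inverse (real (Suc n))) *\<^sub>R \<xi>) \<longlonglongrightarrow> (1 - 0) *\<^sub>R \<xi>"
    by (intro tendsto_intros LIMSEQ_inverse_real_of_nat)
  then show "(\<lambda>n. (1 - inverse (real (Suc n))) *\<^sub>R \<xi>) \<longlonglongrightarrow> \<xi>" by simp
qed

theorem proposition4p1:
  fixes f0 :: "real ^ 'd \<Rightarrow> complex"
    and P :: "'p set"
    and F :: "'p \<Rightarrow> real ^ 'd \<Rightarrow> complex"
    and c :: real
    and Pm :: "nat \<Rightarrow> 'p set"
  assumes "uniform_covering_frame f0 P F"
    and "least_exhausting_constant f0 P F c"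
    and "exhausting_family f0 P F c Pm"
  shows "\<exists>C :: nat \<Rightarrow> real.
           (\<forall>M\<ge>1. 0 < C M \<and> C M < 1) \<and>
           C \<longlonglongrightarrow> 1 \<and>
           (\<forall>M\<ge>1. \<forall>k\<ge>1. \<forall>ps. length ps = k \<and> set ps \<subseteq> P \<longrightarrow>
              (\<forall>f\<in>L2.
                 (L2_norm (convolve (propagator F ps f) f0))\<^sup>2 +
                 (\<Sum>\<^sub>\<infinity>q\<in>Pm M. (L2_norm (convolve (propagator F ps f) (F q)))\<^sup>2)
                 \<ge> C M * (L2_norm (propagator F ps f))\<^sup>2))"
proof -
  have c: "c > 0" using assms(2) by (simp add: least_exhausting_constant_def)
  note frame = assms(1)[unfolded uniform_covering_frame_def]
  have L1_meas: "u \<in> borel_measurable lebesgue" if "u \<in> L1" for u :: "real ^ 'd \<Rightarrow> complex"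
    using that by (auto simp: L1_def)
  have f0: "f0 \<in> L1" "f0 \<in> L2" using frame by auto
  have F: "F p \<in> L1" "F p \<in> L2" if "p \<in> P" for p using frame that by auto
  obtain f0' where f0': "f0' \<in> borel_measurable borel" "AE x in lborel. f0 x = f0' x"
    using borel_version[OF L1_meas[OF f0(1)]] by blast
  have "\<exists>u. u \<in> borel_measurable borel \<and> (AE x in lborel. F p x = u x)" if "p \<in> P" for p
    using borel_version[OF L1_meas[OF F(1)[OF that]]] by blast
  then obtain F' where F': "\<And>p. p \<in> P \<Longrightarrow> F' p \<in> borel_measurable borel"
      "\<And>p. p \<in> P \<Longrightarrow> AE x in lborel. F p x = F' p x"
    by metis
  note f0_AE = L1_meas[OF f0(1)] f0' and F_AE = L1_meas[OF F(1)] F'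
  have f0'_L: "integrable lborel f0'" "f0' \<in> L2_lborel"
    using L1_cong_AE[OF f0_AE f0(1)] L2_cong_AE[OF f0_AE f0(2)] .
  have F'_L: "integrable lborel (F' p)" "F' p \<in> L2_lborel" if "p \<in> P" for p
    using L1_cong_AE[OF F_AE[OF that] F(1)] L2_cong_AE[OF F_AE[OF that] F(2)] that by auto
  have f0_hat: "fourier f0 = fourier f0'" by (rule fourier_cong_AE[OF f0_AE])
  have F_hat: "fourier (F p) = fourier (F' p)" if "p \<in> P" for p
    by (rule fourier_cong_AE[OF F_AE[OF that]])

  \<comment> \<open>With R = c / 4 the quantity 2 R is at most half the radius \<open>c * M\<close>
    for every M \<ge> 1, so \<open>1 - 2 * R / (c * M)\<close> stays at least 1/2.\<close>
  have "c / 4 > 0" using c by simp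
  then obtain N where N: "N > 0" and
    cov: "\<And>p. p \<in> P \<Longrightarrow> \<exists>x :: nat \<Rightarrow> real ^ 'd. ess_support (fourier (F p)) \<subseteq> (\<Union>i<N. cube (c / 4) (x i))"
    using frame by meson

  \<comment> \<open>The first entry is \<open>(1/2)^(2 * d) / N\<close>, from the N small cubes; it
    keeps the constant positive for all M. The second comes from a single cube of radius
    \<open>c * N / 2\<close>, which is admissible only for N \<le> M. As the exponent is even, the
    power would be positive also for N > M, so that case is set to 0 explicitly.\<close>
  define C :: "nat \<Rightarrow> real" where "C M = max ((1 / 4) ^ CARD('d) / real N)
      (if N \<le> M then (1 - real N / real M) ^ (2 * CARD('d)) else 0)" for M
  have C_pos: "0 < C M" for M
    using N by (auto simp: C_def less_max_iff_disj)
  have C_less: "C M < 1" if "M \<ge> 1" for M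
  proof -
    have "(1 / 4) ^ CARD('d) < (1 :: real)" by (rule power_Suc_less_one[of _ "CARD('d) - 1", simplified]) auto
    then have 1: "(1 / 4) ^ CARD('d) / real N < 1"
      using N by (simp add: divide_less_eq)
    have 2: "(1 - real N / real M) ^ (2 * CARD('d)) < 1" if "N \<le> M"
    proof -
      have "0 \<le> 1 - real N / real M" "1 - real N / real M < 1" using that N by auto
      then show ?thesis by (intro power_less_one_iff[THEN iffD2]) auto
    qed
    show ?thesis using 1 2 by (simp add: C_def)
  qed
  have C_lim: "C \<longlonglongrightarrow> 1"
  proof (rule tendsto_sandwich)
    have "(\<lambda>M. (1 - real N / real M) ^ (2 * CARD('d))) \<longlonglongrightarrow> (1 - 0) ^ (2 * CARD('d))"
      by (intro tendsto_intros lim_const_over_n)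
    then show "(\<lambda>M. (1 - real N / real M) ^ (2 * CARD('d))) \<longlonglongrightarrow> 1" by simp
    show "\<forall>\<^sub>F M in sequentially. (1 - real N / real M) ^ (2 * CARD('d)) \<le> C M"
      using eventually_ge_at_top[of N] by eventually_elim (simp add: C_def)
    show "\<forall>\<^sub>F M in sequentially. C M \<le> 1"
      using eventually_ge_at_top[of 1] by eventually_elim (use C_less in \<open>auto intro: less_imp_le\<close>)
  qed simp

  \<comment> \<open>Only the last layer matters: all earlier ones are absorbed in an arbitrary input
    \<open>h\<close> in L2.\<close>
  have main: "C M * (L2_norm g)\<^sup>2 \<le> (L2_norm (convolve g f0'))\<^sup>2 + (\<Sum>\<^sub>\<infinity>q\<in>Pm M. (L2_norm (convolve g (F' q)))\<^sup>2)"
    (is "_ \<le> ?V")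
    if M: "M \<ge> 1" and p: "p \<in> P" and h: "h \<in> L2_lborel"
      and g: "g = (\<lambda>x. complex_of_real (cmod (convolve h (F' p) x)))" for M p h g
  proof -
    have sub: "Pm M \<subseteq> P" using assms(3) M by (simp add: exhausting_family_def)
    have hat: "(\<Sum>\<^sub>\<infinity>q\<in>Pm M. (cmod (fourier (F' q) \<xi>))\<^sup>2) = (\<Sum>\<^sub>\<infinity>q\<in>Pm M. (cmod (fourier (F q) \<xi>))\<^sup>2)" for \<xi>
      using sub by (intro infsum_cong) (auto simp: F_hat)
    have summP: "(\<lambda>q. (cmod (fourier (F q) \<xi>))\<^sup>2) summable_on P" for \<xi> using frame by auto
    then have summA: "(\<lambda>q. (cmod (fourier (F q) \<xi>))\<^sup>2) summable_on Pm M" for \<xi>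
      using sub by (rule summable_on_subset_banach)
    have summ: "(\<lambda>q. (cmod (fourier (F' q) \<xi>))\<^sup>2) summable_on Pm M" for \<xi>
      using summA[of \<xi>] sub by (subst summable_on_cong[of _ _ "\<lambda>q. (cmod (fourier (F q) \<xi>))\<^sup>2"]) (auto simp: F_hat)
    have le1: "(\<Sum>\<^sub>\<infinity>q\<in>Pm M. (cmod (fourier (F' q) \<xi>))\<^sup>2) \<le> 1" for \<xi>
    proof -
      have "(\<Sum>\<^sub>\<infinity>q\<in>Pm M. (cmod (fourier (F q) \<xi>))\<^sup>2) \<le> (\<Sum>\<^sub>\<infinity>q\<in>P. (cmod (fourier (F q) \<xi>))\<^sup>2)"
        using sub by (intro infsum_mono_neutral summA summP) auto
      also have "\<dots> \<le> (cmod (fourier f0 \<xi>))\<^sup>2 + (\<Sum>\<^sub>\<infinity>q\<in>P. (cmod (fourier (F q) \<xi>))\<^sup>2)" by simp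
      also have "\<dots> = 1" using frame by blast
      finally show ?thesis by (simp add: hat)
    qed
    have eq1: "(cmod (fourier f0' \<xi>))\<^sup>2 + (\<Sum>\<^sub>\<infinity>q\<in>Pm M. (cmod (fourier (F' q) \<xi>))\<^sup>2) = 1"
      if "infnorm \<xi> \<le> c * real M" for \<xi>
    proof -
      have "\<xi> \<in> closure (cube (c * real M) 0)"
        using that c M by (intro closure_cube) auto
      then show ?thesis
        using assms(3) M unfolding exhausting_family_def hat f0_hat[symmetric] by blast
    qed
    have FA: "integrable lborel (F' q)" "F' q \<in> L2_lborel" if "q \<in> Pm M" for q
      using F'_L that sub by auto
    have bound: "(1 - 2 * R / (c * real M)) ^ (2 * CARD('d)) / real K * (L2_norm g)\<^sup>2 \<le> ?V"
      if "ess_support (fourier (F' p)) \<subseteq> (\<Union>i<K. cube R (y i))" "0 < R" "2 * R \<le> c * real M" "0 < K" for R K y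
      unfolding g by (rule frame_lower_bound[OF f0'_L F'_L[OF p] FA summ le1 eq1 h that])
    obtain x where x: "ess_support (fourier (F' p)) \<subseteq> (\<Union>i<N. cube (c / 4) (x i))"
      using cov[OF p] F_hat[OF p] by auto
    \<comment> \<open>Covers the case N > M, where the second entry of the maximum is 0.\<close>
    have V: "0 \<le> ?V" by (intro add_nonneg_nonneg infsum_nonneg) auto
    have "(1 / 4) ^ CARD('d) / real N * (L2_norm g)\<^sup>2 \<le> ?V"
    proof -
      have "1 - 2 * (c / 4) / (c * real M) \<ge> 1 / 2" using c M by (simp add: field_simps)
      then have "(1 / 2) ^ (2 * CARD('d)) \<le> (1 - 2 * (c / 4) / (c * real M)) ^ (2 * CARD('d))"
        by (intro power_mono) auto
      then have "(1 / 4) ^ CARD('d) / real N * (L2_norm g)\<^sup>2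
          \<le> (1 - 2 * (c / 4) / (c * real M)) ^ (2 * CARD('d)) / real N * (L2_norm g)\<^sup>2"
        by (intro mult_right_mono divide_right_mono) (auto simp: power_mult power_divide)
      also have "\<dots> \<le> ?V"
      proof (rule bound[OF x])
        show "2 * (c / 4) \<le> c * real M"
          using mult_left_mono[of 1 "real M" c] c M by simp
      qed (use c N in auto)
      finally show ?thesis .
    qed
    moreover have "(1 - real N / real M) ^ (2 * CARD('d)) * (L2_norm g)\<^sup>2 \<le> ?V" if "N \<le> M"
    proof -
      have "connected (ess_support (fourier (F' p)))" using frame p F_hat[OF p] by auto
      \<comment> \<open>N cubes of radius c / 4 give the radius 2 (c / 4) N = c N / 2. The bound is
        then used with one cube, so the only loss is the factor
        \<open>(1 - N / M)^(2 * d)\<close>.\<close>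
      from connected_cubes_subset_cube[OF this _ x] c
      obtain e where e: "ess_support (fourier (F' p)) \<subseteq> cube (c * real N / 2) e" by auto
      have "(1 - 2 * (c * real N / 2) / (c * real M)) ^ (2 * CARD('d)) / real 1 * (L2_norm g)\<^sup>2 \<le> ?V"
        by (rule bound[where y = "\<lambda>_. e"]) (use e c N that in \<open>auto intro: mult_left_mono\<close>)
      then show ?thesis using c by simp
    qed
    ultimately show ?thesis
      using V unfolding C_def by (auto simp: max_def)
  qed

  show ?thesis
  proof (intro exI[of _ C] conjI allI impI ballI C_lim)
    fix M :: nat assume M: "1 \<le> M"
    show "0 < C M" "C M < 1" using C_pos C_less M by auto
    fix k :: nat and ps :: "'p list" and f :: "real ^ 'd \<Rightarrow> complex"
    assume "1 \<le> k" "length ps = k \<and> set ps \<subseteq> P" and f: "f \<in> L2"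
    then have ps: "ps \<noteq> []" "set ps \<subseteq> P" by auto
    have fm: "f \<in> borel_measurable lebesgue" using f by (simp add: L2_def)
    obtain f' where f': "f' \<in> borel_measurable borel" "AE x in lborel. f x = f' x"
      using borel_version[OF fm] by blast
    have f'_L: "f' \<in> L2_lborel" by (rule L2_cong_AE[OF fm f' f])
    \<comment> \<open>The path is cut before its last entry, which exists because k \<ge> 1. The
      earlier entries produce \<open>h\<close>, which is \<open>f'\<close> itself if k = 1, and the
      last filter provides the frequency localisation.\<close>
    define h where "h = propagator F' (butlast ps) f'"
    define g where "g = propagator F ps f"
    have h: "h \<in> L2_lborel" unfolding h_def
      by (rule propagator_L2_lborel[OF F'_L(1) f'_L]) (use ps in \<open>auto dest: in_set_butlastD\<close>)
    have p: "last ps \<in> P" using ps by auto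
    have "g = propagator F' ps f'"
      unfolding g_def by (rule propagator_cong_AE[OF F_AE fm f' ps(2,1)])
    also have "\<dots> = propagator F' (butlast ps @ [last ps]) f'" using ps by simp
    also have "\<dots> = (\<lambda>x. complex_of_real (cmod (convolve h (F' (last ps)) x)))"
      unfolding propagator_append h_def by (simp add: propagator1_def)
    finally have g: "g = (\<lambda>x. complex_of_real (cmod (convolve h (F' (last ps)) x)))" .
    have "h \<in> borel_measurable borel" using h by (simp add: L2_lborel_def)
    then have gm: "g \<in> borel_measurable borel"
      unfolding g using convolve_measurable[OF _ F'(1)[OF p]] by measurable
    then have gl: "g \<in> borel_measurable lebesgue" by (intro measurable_completion) simp
    \<comment> \<open>The convolutions with the representatives agree at every point with those of
      the given frame, so the estimate carries over term by term.\<close>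
    have "convolve g f0 = convolve g f0'"
      by (rule convolve_cong_AE[OF gl gm _ f0_AE]) simp
    moreover have "convolve g (F q) = convolve g (F' q)" if "q \<in> Pm M" for q
    proof -
      have "q \<in> P" using that assms(3) M by (auto simp: exhausting_family_def)
      then show ?thesis by (intro convolve_cong_AE[OF gl gm _ F_AE]) auto
    qed
    ultimately have "C M * (L2_norm g)\<^sup>2 \<le> (L2_norm (convolve g f0))\<^sup>2 + (\<Sum>\<^sub>\<infinity>q\<in>Pm M. (L2_norm (convolve g (F q)))\<^sup>2)"
      using main[OF M p h g] by (simp cong: infsum_cong)
    then show "C M * (L2_norm (propagator F ps f))\<^sup>2 \<le> (L2_norm (convolve (propagator F ps f) f0))\<^sup>2 +
        (\<Sum>\<^sub>\<infinity>q\<in>Pm M. (L2_norm (convolve (propagator F ps f) (F q)))\<^sup>2)"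
      unfolding g_def .
  qed
qed

end
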